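(* Let $p$ be the symbol and $\mathfrak{p}^{-1}\in\mathcal{S}'(\mathbf{R}^n)$ the tempered distribution defined in the context. Then $p\cdot\mathfrak{p}^{-1}=1$ in $\mathcal{S}'(\mathbf{R}^n)$, that is, $\mathfrak{p}^{-1}(p\phi)=\int_{\mathbf{R}^n}\phi(\xi)\,d\xi$ for all $\phi\in\mathcal{S}(\mathbf{R}^n)$.
   Context: Let $n\ge2$ be an integer and $\langle x\rangle=(1+|x|^2)^{1/2}$. The symbol $p\in C^\infty(\mathbf{R}^n)$ is an elliptic symbol of class $S^\mu(\mathbf{R}^n)$ for some real $\mu$: for each multi-index $\alpha$ there is $C_\alpha$ with $|\partial^\alpha p(\xi)|\le C_\alpha\langle\xi\rangle^{\mu-|\alpha|}$ for all $\xi$, and there are positive constants $C,R_0$ with $|p(\xi)|\ge C\langle\xi\rangle^\mu$ for $|\xi|\ge R_0$. Moreover $p(\xi)=g(\xi)\prod_{j=1}^N(|\xi|-r_j)^{q_j}$, where $N$ is a natural number, $0<r_1<\dots<r_N$, the $q_j$ are positive integers, and $g\in C^\infty(\mathbf{R}^n\setminus\{0\})$ with $|g(\xi)|$ bounded from below by a positive constant, bounded from above as $|\xi|\to0$, and at most polynomially increasing as $|\xi|\to\infty$. For $k\in\mathbf{N}$ ($k\ge1$) and $0<\varrho\le\infty$ define, for $\phi\in\mathcal{S}(\mathbf{R})$, $$r_{+,\varrho}^{-k}(\phi)=-\frac{1}{(k-1)!}\int_0^{\varrho}(\ln r)\phi^{(k)}(r)\,dr+\frac{\phi^{(k-1)}(0)}{(k-1)!}\sum_{\nu=1}^{k-1}\frac1\nu-\frac{1}{(k-1)!}\sum_{j=0}^{k-2}\phi^{(j)}(\varrho)\varrho^{-k+j+1}(k-j-2)!,$$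 where the last sum is omitted (zero) if $\varrho=\infty$, and $r_{-,\varrho}^{-k}(\phi)=r_{+,\varrho}^{-k}(\phi(-\cdot))$. For real $b$, $(r-b)_{\pm,\varrho}^{-k}(\phi)=r_{\pm,\varrho}^{-k}(\phi(\cdot+b))$. Let $c_{jk}$ be the constants in the partial fraction decomposition $\prod_{j=1}^N(r-r_j)^{-q_j}=\sum_{j=1}^N\sum_{k=1}^{q_j}c_{jk}(r-r_j)^{-k}$. Write $\xi=r\omega$ with $r\ge0$, $\omega\in S^{n-1}$; for a distribution $T$ in $r$, $(T\otimes1_{S^{n-1}})(\psi)=T\bigl(r\mapsto\int_{S^{n-1}}\psi(r\omega)\,d\omega\bigr)$. Let $\delta_0$ be the Dirac delta on $\mathbf{R}$, $\delta_0^{(\ell)}(h)=(-1)^\ell h^{(\ell)}(0)$. Then, for $\phi\in\mathcal{S}(\mathbf{R}^n)$, $$\mathfrak{p}^{-1}(\phi)=\sum_{j=1}^N\sum_{k=1}^{q_j}c_{jk}\left[(r-r_j)_{+,\infty}^{-k}+(-1)^k(r-r_j)_{-,r_j}^{-k}\right]\otimes1_{S^{n-1}}(r^{n-1}\phi/g)-\sum_{j=1}^N\sum_{k=n}^{q_j}c_{jk}\frac{(-1)^{k-n}\ln r_j}{(k-n)!}\,\delta_0^{(k-n)}\otimes1_{S^{n-1}}(\phi/g),$$ where the inner sum from $k=n$ to $q_j$ is empty if $q_j<n$. Only values at $r\ge0$ of the functions of $(r,\omega)$ enter; values and derivatives at $r=0$ are limits as $r\to0^+$. *)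

theory Defs
  imports "HOL-Analysis.Analysis"
begin

definition partial :: "'n::finite \<Rightarrow> (real^'n \<Rightarrow> complex) \<Rightarrow> real^'n \<Rightarrow> complex" where
  "partial i f x = frechet_derivative f (at x) (axis i 1)"

text \<open>
  A multi-index is represented by a list of coordinate directions; its order is the length
  of the list. On smooth functions mixed partial derivatives commute, so that quantifying over
  all lists amounts to quantifying over all multi-indices in the usual sense.
\<close>

primrec partials :: "'n::finite list \<Rightarrow> (real^'n \<Rightarrow> complex) \<Rightarrow> real^'n \<Rightarrow> complex" where
  "partials [] f = f"
| "partials (i # is) f = partial i (partials is f)"

text \<open>
  Intended for open \<open>S\<close>. Differentiability is total (Frechet) differentiability, so it
  includes existence of the next partial derivatives and continuity of the present ones.
\<close>

definition smooth_on :: "(real^'n::finite) set \<Rightarrow> (real^'n \<Rightarrow> complex) \<Rightarrow> bool" where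
  "smooth_on S f \<longleftrightarrow> (\<forall>is. \<forall>x\<in>S. partials is f differentiable (at x))"

definition japanese :: "real^'n::finite \<Rightarrow> real" where
  "japanese x = sqrt (1 + (norm x)\<^sup>2)"

definition schwartz :: "(real^'n::finite \<Rightarrow> complex) \<Rightarrow> bool" where
  "schwartz f \<longleftrightarrow> smooth_on UNIV f \<and>
     (\<forall>m is. \<exists>C. \<forall>x. japanese x ^ m * norm (partials is f x) \<le> C)"

definition elliptic_symbol :: "real \<Rightarrow> (real^'n::finite \<Rightarrow> complex) \<Rightarrow> bool" where
  "elliptic_symbol \<mu> p \<longleftrightarrow> smooth_on UNIV p \<and>
     (\<forall>is. \<exists>C. \<forall>\<xi>. norm (partials is p \<xi>) \<le> C * japanese \<xi> powr (\<mu> - real (length is))) \<and>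
     (\<exists>C R\<^sub>0. C > 0 \<and> R\<^sub>0 > 0 \<and> (\<forall>\<xi>. norm \<xi> \<ge> R\<^sub>0 \<longrightarrow> norm (p \<xi>) \<ge> C * japanese \<xi> powr \<mu>))"

definition nderiv :: "nat \<Rightarrow> (real \<Rightarrow> complex) \<Rightarrow> real \<Rightarrow> complex" where
  "nderiv k = ((\<lambda>f x. vector_derivative f (at x)) ^^ k)"

text \<open>
  The functional \<open>r\<^sub>+\<^sup>-\<^sup>k\<close> truncated at \<open>\<rho>\<close>, for \<open>k \<ge> 1\<close> and \<open>0 < \<rho> \<le> \<infinity>\<close>.
  It is also applied to functions given only to the left of a finite \<open>\<rho>\<close>; therefore
  \<open>\<phi>\<^sup>(\<^sup>j\<^sup>)(\<rho>)\<close> is taken as the limit from the left, which for smooth \<open>\<phi>\<close>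
  is the ordinary derivative at \<open>\<rho>\<close>.
\<close>

definition rplus :: "nat \<Rightarrow> ereal \<Rightarrow> (real \<Rightarrow> complex) \<Rightarrow> complex" where
  "rplus k \<rho> \<phi> =
     - complex_of_real (1 / fact (k - 1)) * (LBINT r=0..\<rho>. complex_of_real (ln r) * nderiv k \<phi> r)
     + nderiv (k - 1) \<phi> 0 * complex_of_real (1 / fact (k - 1) * (\<Sum>\<nu>=1..k - 1. 1 / real \<nu>))
     - (if \<rho> = \<infinity> then 0
        else complex_of_real (1 / fact (k - 1)) *
          (\<Sum>j<k - 1. Lim (at_left (real_of_ereal \<rho>)) (nderiv j \<phi>) *
             complex_of_real (real_of_ereal \<rho> powi (int j + 1 - int k) * fact (k - j - 2))))"

definition rminus :: "nat \<Rightarrow> ereal \<Rightarrow> (real \<Rightarrow> complex) \<Rightarrow> complex" where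
  "rminus k \<rho> \<phi> = rplus k \<rho> (\<lambda>r. \<phi> (- r))"

definition translated :: "((real \<Rightarrow> complex) \<Rightarrow> complex) \<Rightarrow> real \<Rightarrow> (real \<Rightarrow> complex) \<Rightarrow> complex" where
  "translated T b \<phi> = T (\<lambda>r. \<phi> (r + b))"

text \<open>
  The \<open>l\<close>-th derivative of the Dirac delta at 0, on functions given for positive arguments.
\<close>

definition delta0 :: "nat \<Rightarrow> (real \<Rightarrow> complex) \<Rightarrow> complex" where
  "delta0 l h = (-1) ^ l * Lim (at_right 0) (nderiv l h)"

text \<open>
  Surface measure on the unit sphere: a set \<open>E\<close> has measure \<open>n\<close> times the Lebesgue measure of
  the cone \<open>{t \<omega> | 0 < t \<le> 1, \<omega> \<in> E}\<close>.
\<close>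

definition sphere_measure :: "(real^'n::finite) measure" where
  "sphere_measure = scale_measure (of_nat CARD('n))
     (distr (restrict_space lborel (cball 0 1 - {0})) (restrict_space borel (sphere 0 1)) sgn)"

lemma emeasure_sphere_measure:
  fixes E :: "(real^'n::finite) set"
  assumes "E \<in> sets borel" "E \<subseteq> sphere 0 1"
  shows "emeasure sphere_measure E =
    of_nat CARD('n) * emeasure lborel {t *\<^sub>R \<omega> | t \<omega>. 0 < t \<and> t \<le> 1 \<and> \<omega> \<in> E}"
proof -
  let ?A = "cball 0 1 - {0} :: (real^'n) set"
  have m: "sgn \<in> measurable (restrict_space lborel ?A) (restrict_space borel (sphere 0 1))"
  proof (rule measurable_restrict_space2)
    show "sgn \<in> space (restrict_space lborel ?A) \<rightarrow> sphere 0 1"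
      by (auto simp: space_restrict_space norm_sgn)
    have "continuous_on ?A (sgn :: real^'n \<Rightarrow> real^'n)"
      unfolding sgn_div_norm[abs_def] by (intro continuous_intros) auto
    then have "sgn \<in> borel_measurable (restrict_space borel ?A)"
      by (rule borel_measurable_continuous_on_restrict)
    then show "sgn \<in> measurable (restrict_space lborel ?A) borel"
      using measurable_cong_sets[OF sets_restrict_space_cong[of lborel borel] refl] by fastforce
  qed
  have E: "E \<in> sets (restrict_space borel (sphere 0 1))"
    using assms by (auto simp: sets_restrict_space_iff)
  have "emeasure sphere_measure E = of_nat CARD('n) *
      emeasure (restrict_space lborel ?A) (sgn -` E \<inter> space (restrict_space lborel ?A))"
    unfolding sphere_measure_def by (simp add: emeasure_distr[OF m E])
  also have "emeasure (restrict_space lborel ?A) (sgn -` E \<inter> space (restrict_space lborel ?A)) =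
      emeasure lborel (sgn -` E \<inter> ?A)"
    by (subst emeasure_restrict_space) (auto simp: space_restrict_space)
  also have "sgn -` E \<inter> ?A = {t *\<^sub>R \<omega> | t \<omega>. 0 < t \<and> t \<le> 1 \<and> \<omega> \<in> E}"
  proof (intro set_eqI iffI)
    fix x assume "x \<in> sgn -` E \<inter> ?A"
    then have "x = norm x *\<^sub>R sgn x" "0 < norm x" "norm x \<le> 1" "sgn x \<in> E"
      by (auto simp: sgn_div_norm)
    then show "x \<in> {t *\<^sub>R \<omega> | t \<omega>. 0 < t \<and> t \<le> 1 \<and> \<omega> \<in> E}" by blast
  next
    fix x assume "x \<in> {t *\<^sub>R \<omega> | t \<omega>. 0 < t \<and> t \<le> 1 \<and> \<omega> \<in> E}"
    then show "x \<in> sgn -` E \<inter> ?A" using assms(2)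
      by (auto simp: sgn_div_norm subset_iff)
  qed
  finally show ?thesis .
qed

definition tensor_sphere ::
    "((real \<Rightarrow> complex) \<Rightarrow> complex) \<Rightarrow> (real^'n::finite \<Rightarrow> complex) \<Rightarrow> complex" where
  "tensor_sphere T \<psi> = T (\<lambda>r. \<integral>\<omega>. \<psi> (r *\<^sub>R \<omega>) \<partial>sphere_measure)"

text \<open>
  In the functionals below the radial function is evaluated and differentiated at positive
  radii only; data at radius 0 enter as limits from the right. So neither the value of \<open>g\<close> at 0
  nor the radial function at negative arguments matters.
\<close>

definition inverse_distribution ::
    "nat \<Rightarrow> (nat \<Rightarrow> real) \<Rightarrow> (nat \<Rightarrow> nat) \<Rightarrow> (nat \<Rightarrow> nat \<Rightarrow> real) \<Rightarrow> (real^'n::finite \<Rightarrow> complex)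
      \<Rightarrow> (real^'n \<Rightarrow> complex) \<Rightarrow> complex" where
  "inverse_distribution N r q c g \<phi> =
     (\<Sum>j=1..N. \<Sum>k=1..q j. complex_of_real (c j k) *
        tensor_sphere
          (\<lambda>h. translated (rplus k \<infinity>) (r j) h + (-1) ^ k * translated (rminus k (ereal (r j))) (r j) h)
          (\<lambda>\<xi>. complex_of_real (norm \<xi> ^ (CARD('n) - 1)) * \<phi> \<xi> / g \<xi>))
     - (\<Sum>j=1..N. \<Sum>k=CARD('n)..q j.
        complex_of_real (c j k * ((-1) ^ (k - CARD('n)) * ln (r j) / fact (k - CARD('n)))) *
        tensor_sphere (delta0 (k - CARD('n))) (\<lambda>\<xi>. \<phi> \<xi> / g \<xi>))"

end

theory Submission
  imports Defs
begin

text \<open>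
  In polar coordinates everything reduces to one variable. The radial mean \<open>\<Phi>\<close> of \<open>\<phi>\<close> over
  spheres is a Schwartz function on the line, and \<open>\<integral>\<phi>\<close> is the integral of \<open>f = r\<^sup>n\<^sup>-\<^sup>1 \<Phi>\<close> over the
  half-line. With \<open>P = \<Prod>\<^sub>j (r - r\<^sub>j)\<^sup>q\<^sup>j\<close> the functionals are applied to \<open>P f\<close>, which for \<open>k \<le> q\<^sub>j\<close>
  equals \<open>(r - r\<^sub>j)\<^sup>k u\<^sub>j\<^sub>k\<close> with \<open>u\<^sub>j\<^sub>k\<close> Schwartz. As the numerator cancels the pole, integration by
  parts turns the truncated finite parts into \<open>\<integral> u\<^sub>j\<^sub>k\<close> without any divergent contribution, up to
  the boundary term \<open>ln r\<^sub>j (P f)\<^sup>(\<^sup>k\<^sup>-\<^sup>1\<^sup>)(0) / (k-1)!\<close> at the origin. Because \<open>P f = r\<^sup>n\<^sup>-\<^sup>1 (P \<Phi>)\<close>, that term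
  is \<open>ln r\<^sub>j (P \<Phi>)\<^sup>(\<^sup>k\<^sup>-\<^sup>n\<^sup>)(0) / (k-n)!\<close>, which the delta terms remove. Finally
  \<open>\<Sum> c\<^sub>j\<^sub>k u\<^sub>j\<^sub>k = f\<close> away from the \<open>r\<^sub>j\<close>, by the partial fraction decomposition.
\<close>

section \<open>Schwartz functions on the line\<close>

lemma nderiv_0 [simp]: "nderiv 0 f = f"
  by (simp add: nderiv_def)

lemma nderiv_Suc: "nderiv (Suc m) f x = vector_derivative (nderiv m f) (at x)"
  by (simp add: nderiv_def)

lemma nderiv_nderiv: "nderiv m (nderiv l f) = nderiv (m + l) f"
  by (simp add: nderiv_def funpow_add)

text \<open>A whole sequence of candidate derivatives is guessed at once. Derivatives are unique, so
  induction on the order identifies them with \<open>nderiv\<close>.\<close>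

lemma nderiv_eqI:
  assumes "D 0 = f" "\<And>m x. (D m has_vector_derivative D (Suc m) x) (at x)"
  shows "nderiv m f = D m"
proof (induction m)
  case (Suc m)
  show ?case
    using vector_derivative_at[OF assms(2)] by (auto simp: fun_eq_iff nderiv_Suc Suc)
qed (use assms in simp)

text \<open>Differentiation is local. Since \<open>vector_derivative\<close> chooses among the
  possible derivatives, equality of the sets of possible derivatives is enough, and no
  differentiability has to be known. This is what allows functionals to be evaluated on functions
  prescribed only at positive radii.\<close>

lemma nderiv_cong_open:
  assumes "open S" "x \<in> S" "\<And>y. y \<in> S \<Longrightarrow> f y = g y"
  shows "nderiv m f x = nderiv m g x"
  using assms(2)
proof (induction m arbitrary: x)
  case (Suc m)
  have "(nderiv m f has_vector_derivative d) (at x) \<longleftrightarrow> (nderiv m g has_vector_derivative d) (at x)" for d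
    using has_vector_derivative_transform_within_open[OF _ assms(1) Suc.prems] Suc.IH by metis
  then show ?case
    by (simp add: nderiv_Suc vector_derivative_def)
qed (use assms in simp)

text \<open>As \<open>nderiv\<close> is total, the first conjunct is what makes its values genuine
  derivatives of every order. The weight \<open>1 + \<bar>x\<bar>\<close> is at least 1, so a bound
  with one exponent contains the bounds with smaller ones.\<close>

definition schwartz_real :: "(real \<Rightarrow> complex) \<Rightarrow> bool" where
  "schwartz_real f \<longleftrightarrow> (\<forall>m x. (nderiv m f has_vector_derivative nderiv (Suc m) f x) (at x)) \<and>
     (\<forall>m a. \<exists>C. \<forall>x. (1 + \<bar>x\<bar>) ^ a * norm (nderiv m f x) \<le> C)"

lemma schwartz_realI:
  assumes "D 0 = f" "\<And>m x. (D m has_vector_derivative D (Suc m) x) (at x)"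
    and "\<And>m a. \<exists>C. \<forall>x. (1 + \<bar>x\<bar>) ^ a * norm (D m x) \<le> C"
  shows "schwartz_real f"
  using assms nderiv_eqI[OF assms(1,2)] by (simp add: schwartz_real_def)

lemma schwartz_real_deriv:
  "schwartz_real f \<Longrightarrow> (nderiv m f has_vector_derivative nderiv (Suc m) f x) (at x)"
  by (simp add: schwartz_real_def)

lemma schwartz_real_bound:
  assumes "schwartz_real f"
  obtains C where "C > 0" "\<And>x. (1 + \<bar>x\<bar>) ^ a * norm (nderiv m f x) \<le> C"
proof -
  obtain C where "\<And>x. (1 + \<bar>x\<bar>) ^ a * norm (nderiv m f x) \<le> C"
    using assms unfolding schwartz_real_def by blast
  then show thesis
    by (intro that[of "max C 1"]) (auto simp: le_max_iff_disj)
qed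

lemma schwartz_real_isCont: "schwartz_real f \<Longrightarrow> isCont (nderiv m f) x"
  using has_vector_derivative_continuous schwartz_real_deriv by blast

lemma schwartz_real_nderiv: "schwartz_real f \<Longrightarrow> schwartz_real (nderiv l f)"
  by (simp add: schwartz_real_def nderiv_nderiv)

section \<open>Reflections, translations and linear combinations of Schwartz functions\<close>

lemma nderiv_reflect_deriv:
  assumes "schwartz_real f"
  shows "((\<lambda>x. (-1) ^ m * nderiv m f (b - x)) has_vector_derivative
    (-1) ^ Suc m * nderiv (Suc m) f (b - x)) (at x)"
proof -
  have "((\<lambda>x. b - x) has_vector_derivative - 1) (at x)"
    by (auto intro!: derivative_eq_intros)
  from vector_diff_chain_at[OF this schwartz_real_deriv[OF assms]]
  have "((nderiv m f \<circ> (\<lambda>x. b - x)) has_vector_derivative - nderiv (Suc m) f (b - x)) (at x)"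
    by simp
  from has_vector_derivative_mult_right[OF this, of "(-1) ^ m"] show ?thesis
    by (simp add: o_def)
qed

lemma nderiv_reflect:
  assumes "schwartz_real f"
  shows "nderiv m (\<lambda>x. f (b - x)) x = (-1) ^ m * nderiv m f (b - x)"
  using nderiv_eqI[of "\<lambda>m x. (-1) ^ m * nderiv m f (b - x)" "\<lambda>x. f (b - x)"]
    nderiv_reflect_deriv[OF assms] by simp

lemma schwartz_real_reflect:
  assumes "schwartz_real f"
  shows "schwartz_real (\<lambda>x. f (b - x))"
proof (rule schwartz_realI)
  show "(\<lambda>x. nderiv 0 (\<lambda>x. f (b - x)) x) = (\<lambda>x. f (b - x))" by simp
  fix m x
  show "((\<lambda>x. nderiv m (\<lambda>x. f (b - x)) x) has_vector_derivative nderiv (Suc m) (\<lambda>x. f (b - x)) x) (at x)"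
    unfolding nderiv_reflect[OF assms] by (rule nderiv_reflect_deriv[OF assms])
next
  fix m a
  obtain C where C: "C > 0" "\<And>x. (1 + \<bar>x\<bar>) ^ a * norm (nderiv m f x) \<le> C"
    using schwartz_real_bound[OF assms] by blast
  have "(1 + \<bar>x\<bar>) ^ a * norm (nderiv m (\<lambda>x. f (b - x)) x) \<le> (1 + \<bar>b\<bar>) ^ a * C" for x
  proof -
    \<comment> \<open>A Peetre-type inequality moves the weight from \<open>x\<close> to
      \<open>b - x\<close> at the cost of a constant factor.\<close>
    have "1 + \<bar>x\<bar> \<le> (1 + \<bar>b\<bar>) * (1 + \<bar>b - x\<bar>)"
    proof -
      have "0 \<le> \<bar>b\<bar> * \<bar>b - x\<bar>" "\<bar>x\<bar> \<le> \<bar>b\<bar> + \<bar>b - x\<bar>" by auto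
      moreover have "(1 + \<bar>b\<bar>) * (1 + \<bar>b - x\<bar>) = 1 + \<bar>b\<bar> + \<bar>b - x\<bar> + \<bar>b\<bar> * \<bar>b - x\<bar>"
        by (simp add: algebra_simps)
      ultimately show ?thesis by linarith
    qed
    then have "(1 + \<bar>x\<bar>) ^ a \<le> ((1 + \<bar>b\<bar>) * (1 + \<bar>b - x\<bar>)) ^ a"
      by (intro power_mono) auto
    then have "(1 + \<bar>x\<bar>) ^ a * norm (nderiv m f (b - x))
        \<le> ((1 + \<bar>b\<bar>) * (1 + \<bar>b - x\<bar>)) ^ a * norm (nderiv m f (b - x))"
      by (intro mult_right_mono) auto
    also have "\<dots> = (1 + \<bar>b\<bar>) ^ a * ((1 + \<bar>b - x\<bar>) ^ a * norm (nderiv m f (b - x)))"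
      by (simp add: power_mult_distrib)
    also have "\<dots> \<le> (1 + \<bar>b\<bar>) ^ a * C"
      by (intro mult_left_mono C) auto
    finally show ?thesis
      by (simp add: nderiv_reflect[OF assms] norm_mult norm_power)
  qed
  then show "\<exists>C. \<forall>x. (1 + \<bar>x\<bar>) ^ a * norm (nderiv m (\<lambda>x. f (b - x)) x) \<le> C" by blast
qed

text \<open>The reflections taking \<open>x\<close> to \<open>0 - x\<close> and to
  \<open>- b - x\<close> compose to the translation by \<open>b\<close>.\<close>

lemma schwartz_real_shift:
  assumes "schwartz_real f"
  shows "schwartz_real (\<lambda>x. f (x + b))"
  using schwartz_real_reflect[OF schwartz_real_reflect[OF assms, of 0], of "- b"] by simp

lemma schwartz_real_add:
  assumes f: "schwartz_real f" and g: "schwartz_real g"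
  shows "schwartz_real (\<lambda>x. f x + g x)"
proof (rule schwartz_realI)
  show "(\<lambda>x. nderiv 0 f x + nderiv 0 g x) = (\<lambda>x. f x + g x)" by simp
  show "((\<lambda>x. nderiv m f x + nderiv m g x) has_vector_derivative nderiv (Suc m) f x + nderiv (Suc m) g x) (at x)"
    for m x by (intro has_vector_derivative_add schwartz_real_deriv f g)
  fix m a
  obtain C where C: "C > 0" "\<And>x. (1 + \<bar>x\<bar>) ^ a * norm (nderiv m f x) \<le> C"
    using schwartz_real_bound[OF f] by blast
  obtain D where D: "D > 0" "\<And>x. (1 + \<bar>x\<bar>) ^ a * norm (nderiv m g x) \<le> D"
    using schwartz_real_bound[OF g] by blast
  have "(1 + \<bar>x\<bar>) ^ a * norm (nderiv m f x + nderiv m g x) \<le> C + D" for x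
  proof -
    have "(1 + \<bar>x\<bar>) ^ a * norm (nderiv m f x + nderiv m g x)
        \<le> (1 + \<bar>x\<bar>) ^ a * (norm (nderiv m f x) + norm (nderiv m g x))"
      by (intro mult_left_mono norm_triangle_ineq) auto
    then show ?thesis using C(2)[of x] D(2)[of x] by (simp add: distrib_left)
  qed
  then show "\<exists>C. \<forall>x. (1 + \<bar>x\<bar>) ^ a * norm (nderiv m f x + nderiv m g x) \<le> C" by blast
qed

lemma schwartz_real_cmult:
  assumes f: "schwartz_real f"
  shows "schwartz_real (\<lambda>x. c * f x)"
proof (rule schwartz_realI)
  show "(\<lambda>x. c * nderiv 0 f x) = (\<lambda>x. c * f x)" by simp
  show "((\<lambda>x. c * nderiv m f x) has_vector_derivative c * nderiv (Suc m) f x) (at x)"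
    for m x by (intro has_vector_derivative_mult_right schwartz_real_deriv f)
  fix m a
  obtain C where C: "C > 0" "\<And>x. (1 + \<bar>x\<bar>) ^ a * norm (nderiv m f x) \<le> C"
    using schwartz_real_bound[OF f] by blast
  have "(1 + \<bar>x\<bar>) ^ a * norm (c * nderiv m f x) \<le> norm c * C" for x
    using mult_left_mono[OF C(2)[of x], of "norm c"] by (simp add: norm_mult mult_ac)
  then show "\<exists>C. \<forall>x. (1 + \<bar>x\<bar>) ^ a * norm (c * nderiv m f x) \<le> C" by blast
qed

section \<open>Multiplication by polynomials\<close>

lemma has_vector_derivative_of_real_mult:
  fixes f :: "real \<Rightarrow> complex"
  assumes "(p has_real_derivative p') (at x)" "(f has_vector_derivative f') (at x)"
  shows "((\<lambda>x. of_real (p x) * f x) has_vector_derivative of_real p' * f x + of_real (p x) * f') (at x)"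
proof -
  have "((\<lambda>x. complex_of_real (p x)) has_vector_derivative of_real p') (at x)"
    using assms(1) by (metis has_real_derivative_iff_has_vector_derivative has_vector_derivative_of_real)
  from has_vector_derivative_mult[OF this assms(2)] show ?thesis by (simp add: add.commute)
qed

text \<open>In the Leibniz rule for a product with \<open>x\<close> only two terms survive. At
  \<open>m = 0\<close> the truncated index \<open>m - 1\<close> is harmless because its coefficient
  is 0.\<close>

lemma nderiv_times_ident_deriv:
  assumes "schwartz_real f"
  shows "((\<lambda>x. of_nat m * nderiv (m - 1) f x + of_real x * nderiv m f x) has_vector_derivative
    of_nat (Suc m) * nderiv m f x + of_real x * nderiv (Suc m) f x) (at x)"
proof -
  have 1: "((\<lambda>x. of_nat m * nderiv (m - 1) f x) has_vector_derivative of_nat m * nderiv m f x) (at x)"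
    using schwartz_real_deriv[OF assms]
    by (cases m) (auto intro!: has_vector_derivative_mult_right)
  show ?thesis
    using has_vector_derivative_add[OF 1
        has_vector_derivative_of_real_mult[OF DERIV_ident schwartz_real_deriv[OF assms]]]
    by (simp add: algebra_simps)
qed

lemma nderiv_times_ident:
  assumes "schwartz_real f"
  shows "nderiv m (\<lambda>x. of_real x * f x) x = of_nat m * nderiv (m - 1) f x + of_real x * nderiv m f x"
  using nderiv_eqI[of "\<lambda>m x. of_nat m * nderiv (m - 1) f x + of_real x * nderiv m f x" "\<lambda>x. of_real x * f x" m]
    nderiv_times_ident_deriv[OF assms] by simp

lemma schwartz_real_times_ident:
  assumes f: "schwartz_real f"
  shows "schwartz_real (\<lambda>x. of_real x * f x)"
proof (rule schwartz_realI)
  let ?D = "\<lambda>m x. of_nat m * nderiv (m - 1) f x + of_real x * nderiv m f x"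
  show "?D 0 = (\<lambda>x. of_real x * f x)" by simp
  show "(?D m has_vector_derivative ?D (Suc m) x) (at x)" for m x
    using nderiv_times_ident_deriv[OF f] by simp
  fix m a
  obtain C where C: "C > 0" "\<And>x. (1 + \<bar>x\<bar>) ^ a * norm (nderiv (m - 1) f x) \<le> C"
    using schwartz_real_bound[OF f] by blast
  \<comment> \<open>One additional power of the weight absorbs the factor \<open>x\<close>.\<close>
  obtain D where D: "D > 0" "\<And>x. (1 + \<bar>x\<bar>) ^ Suc a * norm (nderiv m f x) \<le> D"
    using schwartz_real_bound[OF f] by blast
  have "(1 + \<bar>x\<bar>) ^ a * norm (?D m x) \<le> of_nat m * C + D" for x
  proof -
    have "(1 + \<bar>x\<bar>) ^ a * norm (?D m x) \<le>
        (1 + \<bar>x\<bar>) ^ a * (of_nat m * norm (nderiv (m - 1) f x) + (1 + \<bar>x\<bar>) * norm (nderiv m f x))"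
      by (intro mult_left_mono norm_triangle_le add_mono) (auto simp: norm_mult mult_right_mono)
    also have "\<dots> = of_nat m * ((1 + \<bar>x\<bar>) ^ a * norm (nderiv (m - 1) f x))
        + (1 + \<bar>x\<bar>) ^ Suc a * norm (nderiv m f x)"
      by (simp add: algebra_simps)
    also have "\<dots> \<le> of_nat m * C + D"
      by (intro add_mono mult_left_mono C D) auto
    finally show ?thesis .
  qed
  then show "\<exists>C. \<forall>x. (1 + \<bar>x\<bar>) ^ a * norm (?D m x) \<le> C" by blast
qed

lemma schwartz_real_times_linear_power:
  assumes "schwartz_real f"
  shows "schwartz_real (\<lambda>x. of_real ((x - c) ^ k) * f x)"
proof (induction k)
  case (Suc k)
  have "schwartz_real (\<lambda>x. of_real x * (of_real ((x - c) ^ k) * f x)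
      + (- of_real c) * (of_real ((x - c) ^ k) * f x))"
    by (intro schwartz_real_add schwartz_real_times_ident schwartz_real_cmult Suc)
  then show ?case by (simp add: algebra_simps)
qed (use assms in simp)

lemma schwartz_real_times_prod:
  assumes "schwartz_real f" "finite I"
  shows "schwartz_real (\<lambda>x. of_real (\<Prod>i\<in>I. (x - r i) ^ q i) * f x)"
  using assms(2)
proof induction
  case (insert i I)
  from schwartz_real_times_linear_power[OF insert(3), of "r i" "q i"] show ?case
    using insert by (simp add: mult.assoc)
qed (use assms in simp)

text \<open>Division by the factorial turns derivatives at 0 into Taylor coefficients, and
  multiplication by \<open>x ^ a\<close> shifts these by \<open>a\<close>. With
  \<open>a = n - 1\<close> this converts the boundary term at the origin into the one carried by the
  delta functionals.\<close>

lemma nderiv_times_power_at_0: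
  assumes "schwartz_real f"
  shows "nderiv m (\<lambda>x. of_real (x ^ a) * f x) 0 / fact m
    = (if a \<le> m then nderiv (m - a) f 0 / fact (m - a) else 0)"
proof (induction a arbitrary: m)
  case (Suc a)
  let ?g = "\<lambda>x. of_real (x ^ a) * f x"
  have g: "schwartz_real ?g"
    using schwartz_real_times_linear_power[OF assms, of 0 a] by simp
  have *: "nderiv m (\<lambda>x. of_real (x ^ Suc a) * f x) 0 = of_nat m * nderiv (m - 1) ?g 0"
    using nderiv_times_ident[OF g, of m 0] by (simp add: mult.assoc)
  show ?case
  proof (cases m)
    case (Suc l)
    have "nderiv m (\<lambda>x. of_real (x ^ Suc a) * f x) 0 / fact m = nderiv l ?g 0 / fact l"
      unfolding * by (simp add: Suc field_simps del: of_nat_Suc)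
    then show ?thesis using Suc.IH[of l] Suc by (simp del: power_Suc fact_Suc)
  qed (use * in simp)
qed simp

text \<open>Each differentiation lowers the order of the zero at 0 by one and leaves a cofactor that
  is again Schwartz. The remaining zero is what removes the boundary terms at 0 in the integration
  by parts.\<close>

lemma nderiv_times_power:
  assumes "schwartz_real u" "j \<le> k"
  obtains w where "schwartz_real w" "\<And>x. nderiv j (\<lambda>x. of_real (x ^ k) * u x) x = of_real (x ^ (k - j)) * w x"
proof -
  have "\<exists>w. schwartz_real w \<and> nderiv j (\<lambda>x. of_real (x ^ k) * u x) = (\<lambda>x. of_real (x ^ (k - j)) * w x)"
    using assms(2)
  proof (induction j)
    case (Suc j)
    then obtain w where w: "schwartz_real w"
      "nderiv j (\<lambda>x. of_real (x ^ k) * u x) = (\<lambda>x. of_real (x ^ (k - j)) * w x)" by auto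
    obtain i where i: "k - j = Suc i" using Suc.prems by (metis Suc_diff_Suc Suc_le_lessD)
    let ?v = "\<lambda>x. of_nat (Suc i) * w x + of_real x * nderiv 1 w x"
    have "((\<lambda>x. of_real (x ^ Suc i) * w x) has_vector_derivative of_real (x ^ i) * ?v x) (at x)" for x
    proof -
      have "((\<lambda>x. x ^ Suc i) has_real_derivative real (Suc i) * x ^ i) (at x)"
        using DERIV_pow[of "Suc i" x] by simp
      from has_vector_derivative_of_real_mult[OF this schwartz_real_deriv[OF w(1), of 0]]
      show ?thesis by (simp add: algebra_simps)
    qed
    then have "nderiv (Suc j) (\<lambda>x. of_real (x ^ k) * u x) x = of_real (x ^ i) * ?v x" for x
      unfolding nderiv_Suc[of j] w(2) i by (rule vector_derivative_at)
    then have "nderiv (Suc j) (\<lambda>x. of_real (x ^ k) * u x) = (\<lambda>x. of_real (x ^ i) * ?v x)" ..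
    moreover have "schwartz_real ?v"
      by (intro schwartz_real_add schwartz_real_times_ident schwartz_real_cmult w schwartz_real_nderiv)
    moreover have "k - Suc j = i" using i by simp
    ultimately show ?case by metis
  qed (use assms in auto)
  then show thesis using that by metis
qed

section \<open>The truncated functionals at a removable pole\<close>

lemma x_ln_x_tendsto_0: "((\<lambda>x::real. x * ln x) \<longlongrightarrow> 0) (at_right 0)"
proof -
  \<comment> \<open>Substituting \<open>inverse x\<close> reduces the claim to the growth of the
    logarithm at infinity.\<close>
  have "((\<lambda>x::real. - (ln (inverse x) / inverse x)) \<longlongrightarrow> - 0) (at_right 0)"
    by (intro tendsto_minus filterlim_compose[OF ln_x_over_x_tendsto_0 filterlim_inverse_at_top_right])
  moreover have "\<forall>\<^sub>F x in at_right 0. - (ln (inverse x) / inverse x) = x * ln (x::real)"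
    by (intro eventually_at_right_less[THEN eventually_mono]) (auto simp: ln_inverse divide_inverse)
  ultimately show ?thesis
    by (simp add: tendsto_cong)
qed

text \<open>The standard majorant at infinity, used on the line and, after passing to polar
  coordinates, in several variables.\<close>

lemma set_integrable_inverse_square: "set_integrable lborel {0<..} (\<lambda>x::real. 1 / (1 + x) ^ 2)"
proof -
  have "set_integrable lborel (einterval 0 \<infinity>) (\<lambda>x::real. 1 / (1 + x) ^ 2)"
  proof (rule interval_integral_FTC_nonneg(1)[where F = "\<lambda>x. - (1 / (1 + x))"])
    fix x :: real assume "0 < ereal x"
    then have x: "x > 0" by simp
    show "((\<lambda>x. - (1 / (1 + x))) has_real_derivative 1 / (1 + x)\<^sup>2) (at x)"
      using x by (auto intro!: derivative_eq_intros simp: power2_eq_square)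
    show "isCont (\<lambda>x. 1 / (1 + x) ^ 2) x"
      using x by (auto intro!: continuous_intros)
  next
    have "((\<lambda>x::real. - (1 / (1 + x))) \<longlongrightarrow> - (1 / (1 + 0))) (at_right 0)"
      by (intro tendsto_intros) auto
    then show "(((\<lambda>x. - (1 / (1 + x))) \<circ> real_of_ereal) \<longlongrightarrow> - (1 / (1 + 0))) (at_right 0)"
      unfolding zero_ereal_def ereal_tendsto_simps1 .
    have "((\<lambda>x::real. - (1 / (1 + x))) \<longlongrightarrow> - 0) at_top"
      by (intro tendsto_minus tendsto_divide_0[OF tendsto_const] filterlim_at_top_imp_at_infinity
          filterlim_tendsto_add_at_top[OF tendsto_const] filterlim_ident)
    then show "(((\<lambda>x. - (1 / (1 + x))) \<circ> real_of_ereal) \<longlongrightarrow> - 0) (at_left \<infinity>)"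
      unfolding ereal_tendsto_simps1 .
  qed auto
  then show ?thesis by (simp add: zero_ereal_def)
qed

text \<open>The sign makes the integrand nonnegative, so finite limits of the primitive
  \<open>x - x * ln x\<close> at both ends give integrability.\<close>

lemma set_integrable_ln: "set_integrable lborel {0<..<1} (\<lambda>x::real. - ln x)"
proof -
  have "set_integrable lborel (einterval 0 1) (\<lambda>x::real. - ln x)"
  proof (rule interval_integral_FTC_nonneg(1)[where F = "\<lambda>x. x - x * ln x"])
    fix x :: real assume "0 < ereal x"
    then have x: "x > 0" by simp
    show "((\<lambda>x. x - x * ln x) has_real_derivative - ln x) (at x)"
      using x by (auto intro!: derivative_eq_intros)
    show "isCont (\<lambda>x. - ln x) x"
      using x by (auto intro!: continuous_intros)
  next
    have "((\<lambda>x::real. x - x * ln x) \<longlongrightarrow> 0 - 0) (at_right 0)"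
      by (intro tendsto_diff x_ln_x_tendsto_0 tendsto_ident_at)
    then show "(((\<lambda>x. x - x * ln x) \<circ> real_of_ereal) \<longlongrightarrow> 0 - 0) (at_right 0)"
      unfolding zero_ereal_def ereal_tendsto_simps1 .
    have "((\<lambda>x::real. x - x * ln x) \<longlongrightarrow> 1 - 1 * ln 1) (at_left 1)"
      by (intro tendsto_intros) auto
    then show "(((\<lambda>x. x - x * ln x) \<circ> real_of_ereal) \<longlongrightarrow> 1 - 1 * ln 1) (at_left 1)"
      unfolding one_ereal_def ereal_tendsto_simps1 .
  qed auto
  then show ?thesis by (simp add: zero_ereal_def one_ereal_def)
qed

lemma schwartz_real_continuous: "schwartz_real f \<Longrightarrow> continuous_on A f"
  using schwartz_real_isCont[where m = 0] by (simp add: continuous_at_imp_continuous_on)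

lemma schwartz_real_measurable:
  "schwartz_real f \<Longrightarrow> f \<in> borel_measurable borel"
  by (intro borel_measurable_continuous_onI schwartz_real_continuous)

lemma schwartz_real_integrable:
  assumes f: "schwartz_real f"
  shows "set_integrable lborel {0<..} f"
proof -
  obtain C where C: "C > 0" "\<And>x. (1 + \<bar>x\<bar>) ^ 2 * norm (f x) \<le> C"
    using schwartz_real_bound[OF f, of 2 0] by auto
  have "set_integrable lborel {0<..} (\<lambda>x. C * (1 / (1 + x) ^ 2))"
    using set_integrable_inverse_square by (rule set_integrable_mult_right)
  then show ?thesis
  proof (rule set_integrable_bound)
    show "set_borel_measurable lborel {0<..} f"
      using schwartz_real_measurable[OF f] unfolding set_borel_measurable_def by measurable
    show "AE x in lborel. x \<in> {0<..} \<longrightarrow> norm (f x) \<le> norm (C * (1 / (1 + x) ^ 2))"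
    proof (intro AE_I2 impI)
      fix x :: real assume x: "x \<in> {0<..}"
      then have "(1 + x) ^ 2 * norm (f x) \<le> C" using C(2)[of x] by simp
      then show "norm (f x) \<le> norm (C * (1 / (1 + x) ^ 2))"
        using x C(1) by (simp add: pos_le_divide_eq mult.commute)
    qed
  qed
qed

text \<open>The half-line is split at 1. Below 1 the function \<open>f\<close> is bounded and the
  logarithm is integrable. Above 1 the estimate \<open>ln x \<le> 1 + x\<close> costs one power of
  decay, hence the exponent 3 where the majorant has exponent 2.\<close>

lemma schwartz_real_ln_integrable:
  assumes f: "schwartz_real f"
  shows "set_integrable lborel {0<..} (\<lambda>x. complex_of_real (ln x) * f x)"
proof -
  have [measurable]: "f \<in> borel_measurable borel"
    using f by (rule schwartz_real_measurable)
  obtain B where B: "B > 0" "\<And>x. norm (f x) \<le> B"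
    using schwartz_real_bound[OF f, of 0 0] by auto
  obtain C where C: "C > 0" "\<And>x. (1 + \<bar>x\<bar>) ^ 3 * norm (f x) \<le> C"
    using schwartz_real_bound[OF f, of 3 0] by auto
  have "set_integrable lborel {0<..<1} (\<lambda>x. complex_of_real (ln x) * f x)"
  proof (rule set_integrable_bound)
    show "set_integrable lborel {0<..<1} (\<lambda>x. B * - ln x)"
      using set_integrable_ln by (rule set_integrable_mult_right)
    show "set_borel_measurable lborel {0<..<1} (\<lambda>x. complex_of_real (ln x) * f x)"
      unfolding set_borel_measurable_def by measurable
    show "AE x in lborel. x \<in> {0<..<1} \<longrightarrow> norm (complex_of_real (ln x) * f x) \<le> norm (B * - ln x)"
    proof (intro AE_I2 impI)
      fix x :: real assume "x \<in> {0<..<1}"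
      then have "norm (complex_of_real (ln x) * f x) = - ln x * norm (f x)"
        by (simp add: norm_mult)
      also have "\<dots> \<le> - ln x * B"
        using \<open>x \<in> {0<..<1}\<close> B(2) by (intro mult_left_mono) auto
      also have "\<dots> \<le> norm (B * - ln x)" by (simp add: mult.commute)
      finally show "norm (complex_of_real (ln x) * f x) \<le> norm (B * - ln x)" .
    qed
  qed
  moreover have "set_integrable lborel {1..} (\<lambda>x. complex_of_real (ln x) * f x)"
  proof (rule set_integrable_bound)
    show "set_integrable lborel {1..} (\<lambda>x. C * (1 / (1 + x) ^ 2))"
      by (rule set_integrable_mult_right, rule set_integrable_subset[OF set_integrable_inverse_square]) auto
    show "set_borel_measurable lborel {1..} (\<lambda>x. complex_of_real (ln x) * f x)"
      unfolding set_borel_measurable_def by measurable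
    show "AE x in lborel. x \<in> {1..} \<longrightarrow>
        norm (complex_of_real (ln x) * f x) \<le> norm (C * (1 / (1 + x) ^ 2))"
    proof (intro AE_I2 impI)
      fix x :: real assume "x \<in> {1..}"
      then have x: "x \<ge> 1" by simp
      have "ln x \<le> 1 + x" using ln_le_minus_one[of x] x by linarith
      then have "(1 + x) ^ 2 * (ln x * norm (f x)) \<le> (1 + x) ^ 2 * ((1 + x) * norm (f x))"
        using x by (intro mult_left_mono mult_right_mono) auto
      also have "\<dots> = (1 + \<bar>x\<bar>) ^ 3 * norm (f x)"
        using x by (simp add: power_numeral_reduce)
      also have "\<dots> \<le> C" by (rule C)
      finally show "norm (complex_of_real (ln x) * f x) \<le> norm (C * (1 / (1 + x) ^ 2))"
        using x C(1) by (simp add: norm_mult pos_le_divide_eq mult.commute)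
    qed
  qed
  ultimately have "set_integrable lborel ({0<..<1} \<union> {1..}) (\<lambda>x. complex_of_real (ln x) * f x)"
    by (rule set_integrable_Un) auto
  moreover have "{0<..<1} \<union> {1..} = {0::real<..}" by auto
  ultimately show ?thesis by simp
qed

lemma schwartz_real_tendsto_at_top:
  assumes f: "schwartz_real f"
  shows "(f \<longlongrightarrow> 0) at_top" "((\<lambda>x. of_real (ln x) * f x) \<longlongrightarrow> 0) at_top"
proof -
  have *: "(g \<longlongrightarrow> 0) at_top" if g: "schwartz_real g" for g
  proof -
    obtain C where C: "C > 0" "\<And>x. (1 + \<bar>x\<bar>) ^ 1 * norm (g x) \<le> C"
      using schwartz_real_bound[OF g, of 1 0] by auto
    have "((\<lambda>x::real. C / x) \<longlongrightarrow> 0) at_top"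
      by (intro tendsto_divide_0[OF tendsto_const] filterlim_at_top_imp_at_infinity filterlim_ident)
    moreover have "\<forall>\<^sub>F x in at_top. norm (g x) \<le> C / x"
    proof (rule eventually_mono[OF eventually_gt_at_top[of 0]])
      fix x :: real assume "x > 0"
      then have "x * norm (g x) \<le> C"
        using C(2)[of x] norm_ge_zero[of "g x"] by (simp add: distrib_right del: norm_ge_zero)
      then show "norm (g x) \<le> C / x" using \<open>x > 0\<close> by (simp add: field_simps)
    qed
    ultimately show ?thesis by (rule Lim_null_comparison[rotated])
  qed
  show "(f \<longlongrightarrow> 0) at_top" by (rule *[OF f])
  \<comment> \<open>The logarithm is divided by \<open>x\<close>, and \<open>x * f x\<close> is
    again Schwartz.\<close>
  have "((\<lambda>x. of_real (ln x / x) * (of_real x * f x)) \<longlongrightarrow> of_real 0 * 0) at_top"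
    by (intro tendsto_mult tendsto_of_real ln_x_over_x_tendsto_0 * schwartz_real_times_ident f)
  moreover have "\<forall>\<^sub>F x in at_top. of_real (ln x / x) * (of_real x * f x) = of_real (ln x) * f x"
    by (rule eventually_mono[OF eventually_gt_at_top[of 0]]) simp
  ultimately show "((\<lambda>x. of_real (ln x) * f x) \<longlongrightarrow> 0) at_top"
    by (simp add: tendsto_cong)
qed

section \<open>Integration by parts against the logarithm\<close>

context
  fixes u :: "real \<Rightarrow> complex" and m :: nat
  assumes u: "schwartz_real u"
begin

private abbreviation (input) "\<psi> \<equiv> \<lambda>x. of_real (x ^ Suc m) * u x"

text \<open>For \<open>i \<ge> 1\<close> this is the \<open>i\<close>-th derivative of the logarithm
  up to the sign \<open>(-1) ^ (i - 1)\<close>.\<close>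

private abbreviation (input) T :: "nat \<Rightarrow> real \<Rightarrow> real" where
  "T i s \<equiv> fact (i - 1) / s ^ i"

private lemma \<psi>: "schwartz_real \<psi>"
  using schwartz_real_times_linear_power[OF u, of 0 "Suc m"] by simp

private lemma nderiv_\<psi>_factor:
  "j \<le> Suc m \<Longrightarrow> \<exists>w. schwartz_real w \<and> (\<forall>x. nderiv j \<psi> x = of_real (x ^ (Suc m - j)) * w x)"
  using nderiv_times_power[OF u] by metis

text \<open>
  Integrating \<open>\<psi>(s) / s\<^sup>k\<close> by parts \<open>k = Suc m\<close> times leaves these boundary terms, so \<open>A / m!\<close> is a
  primitive of \<open>u + ln \<cdot> \<psi>\<^sup>(\<^sup>k\<^sup>) / m!\<close>.
\<close>

private definition A :: "real \<Rightarrow> complex" where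
  "A s = - (\<Sum>j<m. of_real (T (m - j) s) * nderiv j \<psi> s) + of_real (ln s) * nderiv m \<psi> s"

text \<open>The derivatives of the boundary terms telescope. The end \<open>B m\<close> is
  \<open>nderiv m \<psi> s / s\<close> and cancels against the derivative of the logarithm. The end
  \<open>B 0\<close> is \<open>fact m * u s\<close>, because the power of \<open>s\<close> in
  \<open>T (Suc m) s\<close> cancels the one in \<open>\<psi>\<close>.\<close>

private lemma A_deriv:
  assumes s: "s > 0"
  shows "(A has_vector_derivative fact m * u s + of_real (ln s) * nderiv (Suc m) \<psi> s) (at s)"
proof -
  define B where "B j = of_real (T (Suc m - j) s) * nderiv j \<psi> s" for j
  have T: "(T (Suc i) has_real_derivative - T (Suc (Suc i)) s) (at s)" for i
  proof -
    have "(T (Suc i) has_real_derivative - (fact i * (real (Suc i) * s ^ i)) / (s ^ Suc i * s ^ Suc i)) (at s)"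
      using DERIV_divide[OF DERIV_const[of "fact i"] DERIV_pow[of "Suc i" s]] s by simp
    also have "- (fact i * (real (Suc i) * s ^ i)) / (s ^ Suc i * s ^ Suc i) = - T (Suc (Suc i)) s"
      using s by (simp add: field_simps)
    finally show ?thesis .
  qed
  have B: "((\<lambda>s. of_real (T (m - j) s) * nderiv j \<psi> s) has_vector_derivative B (Suc j) - B j) (at s)"
    if "j < m" for j
  proof -
    define i where "i = m - Suc j"
    have i: "m - j = Suc i" "Suc m - j = Suc (Suc i)"
      using that by (simp_all add: i_def)
    show ?thesis
      using has_vector_derivative_of_real_mult[OF T schwartz_real_deriv[OF \<psi>], of i j]
      by (simp add: B_def i diff_Suc_Suc del: power_Suc)
  qed
  have "((\<lambda>s. of_real (ln s) * nderiv m \<psi> s) has_vector_derivative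
      of_real (1 / s) * nderiv m \<psi> s + of_real (ln s) * nderiv (Suc m) \<psi> s) (at s)"
    using s by (intro has_vector_derivative_of_real_mult schwartz_real_deriv \<psi>)
      (auto intro!: derivative_eq_intros)
  then have "(A has_vector_derivative - (\<Sum>j<m. B (Suc j) - B j) +
      (of_real (1 / s) * nderiv m \<psi> s + of_real (ln s) * nderiv (Suc m) \<psi> s)) (at s)"
    unfolding A_def[abs_def]
    by (intro has_vector_derivative_add has_vector_derivative_minus has_vector_derivative_sum B) auto
  also have "(\<Sum>j<m. B (Suc j) - B j) = B m - B 0"
    by (rule sum_lessThan_telescope)
  also have "- (B m - B 0) + (of_real (1 / s) * nderiv m \<psi> s + of_real (ln s) * nderiv (Suc m) \<psi> s)
      = fact m * u s + of_real (ln s) * nderiv (Suc m) \<psi> s"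
    using s by (simp add: B_def)
  finally show ?thesis .
qed

text \<open>The zero of \<open>nderiv j \<psi>\<close> at 0 has order at least
  \<open>Suc m - j\<close>, one more than the exponent in \<open>T (m - j)\<close>, so every
  boundary term keeps a factor \<open>s\<close>. The logarithmic term keeps
  \<open>s * ln s\<close>.\<close>

private lemma A_at_0: "(A \<longlongrightarrow> 0) (at_right 0)"
proof -
  have *: "((\<lambda>s. of_real (T (m - j) s) * nderiv j \<psi> s) \<longlongrightarrow> 0) (at_right 0)" if "j < m" for j
  proof -
    have "j \<le> Suc m" using that by simp
    from nderiv_\<psi>_factor[OF this] obtain w where w: "schwartz_real w" "\<And>x. nderiv j \<psi> x = of_real (x ^ (Suc m - j)) * w x"
      by blast
    have "((\<lambda>s. of_real (fact (m - j - 1) * s) * w s) \<longlongrightarrow> of_real (fact (m - j - 1) * 0) * w 0) (at_right 0)"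
      using schwartz_real_isCont[OF w(1), where m = 0 and x = 0]
      by (intro tendsto_intros) (simp add: isCont_def filterlim_at_split)
    moreover have "\<forall>\<^sub>F s in at_right 0. of_real (fact (m - j - 1) * s) * w s = of_real (T (m - j) s) * nderiv j \<psi> s"
    proof (rule eventually_mono[OF eventually_at_right_less])
      fix s :: real assume "0 < s"
      moreover have "Suc m - j = Suc (m - j)" using that by simp
      ultimately show "of_real (fact (m - j - 1) * s) * w s = of_real (T (m - j) s) * nderiv j \<psi> s"
        unfolding w(2) by (simp add: field_simps)
    qed
    ultimately show ?thesis by (simp add: tendsto_cong)
  qed
  obtain w where w: "schwartz_real w" "\<And>x. nderiv m \<psi> x = of_real (x ^ 1) * w x"
    using nderiv_\<psi>_factor[of m] by auto
  have "((\<lambda>s. of_real (s * ln s) * w s) \<longlongrightarrow> of_real 0 * w 0) (at_right 0)"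
    using schwartz_real_isCont[OF w(1), where m = 0 and x = 0]
    by (intro tendsto_mult tendsto_of_real x_ln_x_tendsto_0) (simp add: isCont_def filterlim_at_split)
  then have "((\<lambda>s. of_real (ln s) * nderiv m \<psi> s) \<longlongrightarrow> 0) (at_right 0)"
    unfolding w(2) by (simp add: mult_ac)
  then have "(A \<longlongrightarrow> - (\<Sum>j<m. 0) + 0) (at_right 0)"
    unfolding A_def[abs_def] by (intro tendsto_intros *) auto
  then show ?thesis by simp
qed

private lemma A_at_top: "(A \<longlongrightarrow> 0) at_top"
proof -
  have "((\<lambda>s. of_real (T (m - j) s) * nderiv j \<psi> s) \<longlongrightarrow> of_real 0 * 0) at_top" if "j < m" for j
    using that
    by (intro tendsto_mult tendsto_of_real tendsto_divide_0[OF tendsto_const] filterlim_at_top_imp_at_infinity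
        filterlim_pow_at_top filterlim_ident schwartz_real_tendsto_at_top(1) schwartz_real_nderiv \<psi>) auto
  then have "(A \<longlongrightarrow> - (\<Sum>j<m. 0) + 0) at_top"
    unfolding A_def[abs_def]
    by (intro tendsto_intros schwartz_real_tendsto_at_top(2) schwartz_real_nderiv \<psi>) auto
  then show ?thesis by simp
qed

text \<open>As \<open>A\<close> tends to 0 at the origin, the fundamental theorem leaves only the
  limit at the upper end. Both summands are integrable on their own, so the integral may be
  split.\<close>

private lemma integral_A:
  assumes "0 < \<rho>" "((A \<circ> real_of_ereal) \<longlongrightarrow> L) (at_left \<rho>)"
  shows "(LBINT s=0..\<rho>. of_real (ln s) * nderiv (Suc m) \<psi> s) = L - fact m * (LINT s:einterval 0 \<rho>|lborel. u s)"
proof -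
  have sub: "einterval 0 \<rho> \<subseteq> {0<..}" by (auto simp: einterval_def)
  have i1: "set_integrable lborel (einterval 0 \<rho>) (\<lambda>s. fact m * u s)"
    by (intro set_integrable_mult_right set_integrable_subset[OF schwartz_real_integrable[OF u]] sub) auto
  have i2: "set_integrable lborel (einterval 0 \<rho>) (\<lambda>s. of_real (ln s) * nderiv (Suc m) \<psi> s)"
    by (intro set_integrable_subset[OF schwartz_real_ln_integrable[OF schwartz_real_nderiv[OF \<psi>]]] sub) auto
  have "(LBINT s=0..\<rho>. fact m * u s + of_real (ln s) * nderiv (Suc m) \<psi> s) = L - 0"
  proof (rule interval_integral_FTC_integrable[OF assms(1) _ _ _ _ assms(2)])
    fix s :: real assume "0 < ereal s"
    then have s: "0 < s" by simp
    show "(A has_vector_derivative fact m * u s + of_real (ln s) * nderiv (Suc m) \<psi> s) (at s)"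
      by (rule A_deriv[OF s])
    show "isCont (\<lambda>s. fact m * u s + of_real (ln s) * nderiv (Suc m) \<psi> s) s"
      using s schwartz_real_isCont[OF u, where m = 0 and x = s] schwartz_real_isCont[OF \<psi>, where m = "Suc m" and x = s]
      by (intro continuous_intros) (auto simp del: power_Suc)
  next
    show "set_integrable lborel (einterval 0 \<rho>) (\<lambda>s. fact m * u s + of_real (ln s) * nderiv (Suc m) \<psi> s)"
      using i1 i2 by (rule set_integral_add)
    show "((A \<circ> real_of_ereal) \<longlongrightarrow> 0) (at_right 0)"
      unfolding zero_ereal_def ereal_tendsto_simps1 by (rule A_at_0)
  qed
  then show ?thesis
    using assms(1) set_integral_add(2)[OF i1 i2]
    by (simp add: interval_lebesgue_integral_le_eq algebra_simps)
qed

text \<open>The boundary sum in \<open>rplus\<close> cancels the sum contained in \<open>A\<close>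
  at the upper end, leaving the logarithmic term alone. The harmonic sum drops out because
  \<open>nderiv m \<psi>\<close> still vanishes at 0. Agreement of \<open>\<phi>\<close> with the
  product is asked for on \<open>(- e, \<rho>)\<close> since \<open>rplus\<close> sees the integral
  over \<open>(0, \<rho>)\<close>, a derivative at 0, which is interior as \<open>e > 0\<close>, and
  limits from the left at a finite \<open>\<rho>\<close>.\<close>

lemma rplus_times_power:
  assumes \<rho>: "0 < \<rho>" and e: "e > 0"
    and \<phi>: "\<And>x. - e < x \<Longrightarrow> ereal x < \<rho> \<Longrightarrow> \<phi> x = of_real (x ^ Suc m) * u x"
  shows "rplus (Suc m) \<rho> \<phi> = (LINT s:einterval 0 \<rho>|lborel. u s) -
    (if \<rho> = \<infinity> then 0 else of_real (ln (real_of_ereal \<rho>)) *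
      nderiv m (\<lambda>x. of_real (x ^ Suc m) * u x) (real_of_ereal \<rho>) / fact m)"
proof -
  have nd: "nderiv j \<phi> x = nderiv j \<psi> x" if "- e < x" "ereal x < \<rho>" for j x
  proof (rule nderiv_cong_open[OF open_einterval])
    show "x \<in> einterval (ereal (- e)) \<rho>" using that by (simp add: einterval_def)
    show "\<phi> y = \<psi> y" if "y \<in> einterval (ereal (- e)) \<rho>" for y
      using that by (intro \<phi>) (simp_all add: einterval_def)
  qed
  have "\<exists>w. schwartz_real w \<and> (\<forall>x. nderiv m \<psi> x = of_real (x ^ (Suc m - m)) * w x)"
    by (rule nderiv_\<psi>_factor) simp
  then have "nderiv m \<psi> 0 = 0" by auto
  moreover have "nderiv m \<phi> 0 = nderiv m \<psi> 0"
    using \<rho> e by (intro nd) (simp_all add: zero_ereal_def)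
  ultimately have nd0: "nderiv m \<phi> 0 = 0" by (rule trans[rotated])
  have int: "(LBINT s=0..\<rho>. of_real (ln s) * nderiv (Suc m) \<phi> s) = (LBINT s=0..\<rho>. of_real (ln s) * nderiv (Suc m) \<psi> s)"
  proof (rule interval_integral_cong)
    fix s assume "s \<in> einterval (min 0 \<rho>) (max 0 \<rho>)"
    then have "- e < s" "ereal s < \<rho>" using \<rho> e by (auto simp: einterval_def)
    then show "of_real (ln s) * nderiv (Suc m) \<phi> s = of_real (ln s) * nderiv (Suc m) \<psi> s"
      by (simp only: nd)
  qed
  show ?thesis
  proof (cases "\<rho> = \<infinity>")
    case True
    have "((A \<circ> real_of_ereal) \<longlongrightarrow> 0) (at_left \<rho>)"
      unfolding True ereal_tendsto_simps1 by (rule A_at_top)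
    note I = int[THEN trans, OF integral_A[OF \<rho> this]]
    show ?thesis
      by (simp add: rplus_def nd0 True I[unfolded True])
  next
    case False
    then obtain b where b: "\<rho> = ereal b" using \<rho> by (cases \<rho>) auto
    then have b0: "b > 0" using \<rho> by simp
    have "(A \<longlongrightarrow> A b) (at_left b)"
      using has_vector_derivative_continuous[OF A_deriv[OF b0]]
      by (simp add: isCont_def filterlim_at_split)
    then have "((A \<circ> real_of_ereal) \<longlongrightarrow> A b) (at_left \<rho>)"
      unfolding b ereal_tendsto_simps1 .
    note I = int[THEN trans, OF integral_A[OF \<rho> this]]
    have lim: "Lim (at_left b) (nderiv j \<phi>) = nderiv j \<psi> b" for j
    proof (rule tendsto_Lim)
      have "(nderiv j \<psi> \<longlongrightarrow> nderiv j \<psi> b) (at_left b)"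
        using schwartz_real_isCont[OF \<psi>, where m = j and x = b] by (simp add: isCont_def filterlim_at_split)
      moreover have "\<forall>\<^sub>F x in at_left b. nderiv j \<psi> x = nderiv j \<phi> x"
        using b0 e by (intro eventually_mono[OF eventually_at_leftI[of "-e" b]]) (auto simp: nd b)
      ultimately show "(nderiv j \<phi> \<longlongrightarrow> nderiv j \<psi> b) (at_left b)"
        by (simp add: tendsto_cong)
    qed simp
    have S: "(\<Sum>j<m. Lim (at_left b) (nderiv j \<phi>) * complex_of_real (b powi (int j + 1 - int (Suc m)) * fact (Suc m - j - 2)))
        = (\<Sum>j<m. of_real (T (m - j) b) * nderiv j \<psi> b)"
    proof (rule sum.cong[OF refl])
      fix j assume "j \<in> {..<m}"
      \<comment> \<open>With \<open>k = Suc m\<close> the exponent and the factorial in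
        \<open>rplus\<close> are those of \<open>T (m - j) b\<close>.\<close>
      then have E: "int j + 1 - int (Suc m) = - int (m - j)" "Suc m - j - 2 = m - j - 1" by simp_all
      show "Lim (at_left b) (nderiv j \<phi>) * complex_of_real (b powi (int j + 1 - int (Suc m)) * fact (Suc m - j - 2))
          = of_real (T (m - j) b) * nderiv j \<psi> b"
        unfolding E lim power_int_minus power_int_of_nat divide_inverse
        by (simp only: mult.commute)
    qed
    have "rplus (Suc m) \<rho> \<phi> = - of_real (1 / fact m) * (A b - fact m * (LINT s:einterval 0 \<rho>|lborel. u s))
        - of_real (1 / fact m) * (\<Sum>j<m. of_real (T (m - j) b) * nderiv j \<psi> b)"
      unfolding rplus_def using S nd0 I b by simp
    also have "\<dots> = (LINT s:einterval 0 \<rho>|lborel. u s) - of_real (ln b) * nderiv m \<psi> b / fact m"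
      by (simp add: A_def divide_simps)
    finally show ?thesis
      using False b by simp
  qed
qed

end

section \<open>Polar coordinates\<close>

lemma space_sphere_measure [simp]: "space (sphere_measure :: (real^'n::finite) measure) = sphere 0 1"
  by (simp add: sphere_measure_def space_scale_measure space_restrict_space)

lemma sets_sphere_measure [measurable_cong]:
  "sets (sphere_measure :: (real^'n::finite) measure) = sets (restrict_space borel (sphere 0 1))"
  by (simp add: sphere_measure_def)

lemma measurable_sphere_measure:
  "f \<in> borel_measurable borel \<Longrightarrow> f \<in> borel_measurable (sphere_measure :: (real^'n::finite) measure)"
  unfolding measurable_cong_sets[OF sets_sphere_measure refl] by (rule measurable_restrict_space1)

lemma measurable_sgn_sphere:
  "sgn \<in> measurable (restrict_space lborel (cball 0 1 - {0})) (restrict_space borel (sphere 0 1 :: (real^'n::finite) set))"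
proof (rule measurable_restrict_space2)
  show "sgn \<in> space (restrict_space lborel (cball 0 1 - {0})) \<rightarrow> sphere (0 :: real^'n) 1"
    by (auto simp: space_restrict_space norm_sgn)
  show "sgn \<in> borel_measurable (restrict_space lborel (cball 0 1 - {0} :: (real^'n) set))"
    unfolding sgn_div_norm[abs_def] by (intro measurable_restrict_space1) measurable
qed

lemma nn_integral_sphere_measure:
  fixes f :: "real^'n::finite \<Rightarrow> ennreal"
  assumes f [measurable]: "f \<in> borel_measurable borel"
  shows "(\<integral>\<^sup>+\<omega>. f \<omega> \<partial>sphere_measure) =
    of_nat CARD('n) * (\<integral>\<^sup>+x. f (sgn x) * indicator (cball 0 1 - {0}) x \<partial>lborel)"
proof -
  have f': "f \<in> borel_measurable (restrict_space borel (sphere 0 1))"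
    using f by (rule measurable_restrict_space1)
  have "(\<integral>\<^sup>+\<omega>. f \<omega> \<partial>sphere_measure) =
      of_nat CARD('n) * (\<integral>\<^sup>+x. f (sgn x) \<partial>restrict_space lborel (cball 0 1 - {0}))"
    unfolding sphere_measure_def using f'
    by (simp add: nn_integral_scale_measure nn_integral_distr measurable_sgn_sphere)
  then show ?thesis
    by (simp add: nn_integral_restrict_space)
qed

lemma finite_sphere_measure: "finite_measure (sphere_measure :: (real^'n::finite) measure)"
proof
  have "emeasure lborel (cball 0 1 - {0} :: (real^'n) set) \<le> emeasure lborel (cball 0 1 :: (real^'n) set)"
    by (intro emeasure_mono) auto
  also have "\<dots> < \<infinity>"
    using emeasure_lborel_cball_finite by auto
  finally have "emeasure lborel (cball 0 1 - {0} :: (real^'n) set) \<noteq> \<infinity>" by simp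
  moreover have "emeasure (sphere_measure :: (real^'n) measure) (space sphere_measure) = \<integral>\<^sup>+(\<omega> :: real^'n). 1 \<partial>sphere_measure"
    by simp
  ultimately show "emeasure (sphere_measure :: (real^'n) measure) (space sphere_measure) \<noteq> \<infinity>"
    using nn_integral_sphere_measure[of "\<lambda>_::real^'n. 1"]
    by (simp add: ennreal_mult_eq_top_iff del: space_sphere_measure)
qed

section \<open>Polar coordinates for nonnegative functions\<close>

lemma nn_integral_lborel_scaleR:
  fixes f :: "'a::euclidean_space \<Rightarrow> ennreal"
  assumes [measurable]: "f \<in> borel_measurable borel" and c: "c > 0"
  shows "(\<integral>\<^sup>+x. f x \<partial>lborel) = ennreal (c ^ DIM('a)) * (\<integral>\<^sup>+x. f (c *\<^sub>R x) \<partial>lborel)"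
  using c by (subst lborel_affine[of c 0])
    (simp_all add: nn_integral_density nn_integral_distr nn_integral_cmult)

lemma nn_integral_inverse_power:
  fixes a :: real
  assumes "a > 0" "n > 0"
  shows "(\<integral>\<^sup>+s. ennreal (1 / s ^ Suc n) * indicator {a..} s \<partial>lborel) = ennreal (1 / (real n * a ^ n))"
proof -
  have "(\<integral>\<^sup>+s. ennreal (1 / s ^ Suc n) * indicator {a..} s \<partial>lborel) = ennreal (0 - - (1 / (real n * a ^ n)))"
  proof (rule nn_integral_FTC_atLeast)
    fix s assume "a \<le> s"
    then have s: "s > 0" using assms by simp
    show "((\<lambda>s. - (1 / (real n * s ^ n))) has_real_derivative 1 / s ^ Suc n) (at s)"
    proof -
      obtain k where k: "n = Suc k" using assms by (cases n) auto
      have "((\<lambda>s. (- 1 / real n) / s ^ n) has_real_derivative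
          (0 * s ^ n - (- 1 / real n) * (real n * s ^ (n - 1))) / (s ^ n * s ^ n)) (at s)"
        using DERIV_divide[OF DERIV_const[of "- 1 / real n"] DERIV_pow[of n s]] s by simp
      also have "(\<lambda>s. (- 1 / real n) / s ^ n) = (\<lambda>s. - (1 / (real n * s ^ n)))"
        by simp
      also have "(0 * s ^ n - (- 1 / real n) * (real n * s ^ (n - 1))) / (s ^ n * s ^ n) = 1 / s ^ Suc n"
        using s unfolding k by simp
      finally show ?thesis .
    qed
    show "0 \<le> 1 / s ^ Suc n" using s by simp
  next
    have "((\<lambda>s. 1 / (real n * s ^ n)) \<longlongrightarrow> 0) at_top"
      using assms
      by (intro tendsto_divide_0[OF tendsto_const] filterlim_at_top_imp_at_infinity
          filterlim_tendsto_pos_mult_at_top[OF tendsto_const] filterlim_pow_at_top filterlim_ident) auto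
    from tendsto_minus[OF this] show "((\<lambda>s. - (1 / (real n * s ^ n))) \<longlongrightarrow> 0) at_top" by simp
  qed simp
  then show ?thesis by simp
qed

text \<open>
  The sphere measure turns the right-hand side into an integral over \<open>r > 0\<close> and \<open>x\<close> in the unit
  ball. Substituting \<open>r = s |x|\<close> and then \<open>y = s x\<close> leaves \<open>f(y)\<close> with the weight
  \<open>n |y|\<^sup>n \<integral> s\<^sup>-\<^sup>n\<^sup>-\<^sup>1 ds\<close> over \<open>s \<ge> |y|\<close>, which is 1.
\<close>

lemma nn_integral_polar:
  fixes f :: "real^'n::finite \<Rightarrow> ennreal"
  assumes f [measurable]: "f \<in> borel_measurable borel"
  shows "(\<integral>\<^sup>+x. f x \<partial>lborel) =
    (\<integral>\<^sup>+r. ennreal (r ^ (CARD('n) - 1)) * indicator {0<..} r * (\<integral>\<^sup>+\<omega>. f (r *\<^sub>R \<omega>) \<partial>sphere_measure) \<partial>lborel)"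
proof -
  define n where "n = CARD('n)"
  have n: "n > 0" by (simp add: n_def)
  have np: "a ^ n = a * a ^ (n - 1)" for a :: real
    using n by (cases n) auto
  define A where "A = cball 0 1 - {0 :: real^'n}"
  have [measurable]: "A \<in> sets borel" by (simp add: A_def)
  have [measurable]: "sgn \<in> borel_measurable (borel :: (real^'n) measure)"
    unfolding sgn_div_norm[abs_def] by measurable
  have "(\<integral>\<^sup>+r. ennreal (r ^ (n - 1)) * indicator {0<..} r * (\<integral>\<^sup>+\<omega>. f (r *\<^sub>R \<omega>) \<partial>sphere_measure) \<partial>lborel)
      = (\<integral>\<^sup>+r. \<integral>\<^sup>+x. of_nat n * (ennreal (r ^ (n - 1)) * indicator {0<..} r * (f (r *\<^sub>R sgn x) * indicator A x)) \<partial>lborel \<partial>lborel)"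
  proof (rule nn_integral_cong)
    fix r :: real
    let ?c = "ennreal (r ^ (n - 1)) * indicator {0<..} r"
    have "?c * (\<integral>\<^sup>+\<omega>. f (r *\<^sub>R \<omega>) \<partial>sphere_measure)
        = of_nat n * (?c * (\<integral>\<^sup>+x. f (r *\<^sub>R sgn x) * indicator A x \<partial>lborel))"
      by (subst nn_integral_sphere_measure) (simp_all add: n_def A_def mult_ac)
    also have "\<dots> = (\<integral>\<^sup>+x. of_nat n * (?c * (f (r *\<^sub>R sgn x) * indicator A x)) \<partial>lborel)"
    proof -
      have "(\<lambda>x. f (r *\<^sub>R sgn x) * indicator A x) \<in> borel_measurable lborel"
        by measurable
      from nn_integral_cmult[OF this, of "of_nat n * ?c"] show ?thesis
        by (simp only: mult.assoc)
    qed
    finally show "?c * (\<integral>\<^sup>+\<omega>. f (r *\<^sub>R \<omega>) \<partial>sphere_measure)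
        = (\<integral>\<^sup>+x. of_nat n * (?c * (f (r *\<^sub>R sgn x) * indicator A x)) \<partial>lborel)" .
  qed
  also have "\<dots> = (\<integral>\<^sup>+x. \<integral>\<^sup>+r. of_nat n * (ennreal (r ^ (n - 1)) * indicator {0<..} r * (f (r *\<^sub>R sgn x) * indicator A x)) \<partial>lborel \<partial>lborel)"
    by (rule lborel_pair.Fubini'[symmetric]) measurable
  also have "\<dots> = (\<integral>\<^sup>+x. \<integral>\<^sup>+s. of_nat n * (ennreal (norm x ^ n * s ^ (n - 1)) * indicator {0<..} s * (f (s *\<^sub>R x) * indicator A x)) \<partial>lborel \<partial>lborel)"
  proof (rule nn_integral_cong)
    fix x :: "real^'n"
    show "(\<integral>\<^sup>+r. of_nat n * (ennreal (r ^ (n - 1)) * indicator {0<..} r * (f (r *\<^sub>R sgn x) * indicator A x)) \<partial>lborel)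
        = (\<integral>\<^sup>+s. of_nat n * (ennreal (norm x ^ n * s ^ (n - 1)) * indicator {0<..} s * (f (s *\<^sub>R x) * indicator A x)) \<partial>lborel)"
    proof (cases "x = 0")
      case False
      have "ennreal (norm x) * (of_nat n * (ennreal ((norm x * s) ^ (n - 1)) * indicator {0<..} (norm x * s) * (f ((norm x * s) *\<^sub>R sgn x) * indicator A x)))
          = of_nat n * (ennreal (norm x ^ n * s ^ (n - 1)) * indicator {0<..} s * (f (s *\<^sub>R x) * indicator A x))" for s
      proof (cases "s > 0")
        case True
        have "(norm x * s) *\<^sub>R sgn x = s *\<^sub>R x"
          using False by (simp add: sgn_div_norm)
        moreover have "ennreal (norm x ^ n * s ^ (n - 1)) = ennreal (norm x) * ennreal ((norm x * s) ^ (n - 1))"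
          using True by (simp add: ennreal_mult[symmetric] power_mult_distrib np[of "norm x"] mult.assoc)
        ultimately show ?thesis using True False by (simp add: A_def mult_ac)
      next
        case False
        then have "indicator {0<..} (norm x * s) = (0::ennreal)"
          by (simp add: indicator_def mult_nonneg_nonpos not_less)
        then show ?thesis using False by simp
      qed
      note eq = this
      define H where "H r = of_nat n * (ennreal (r ^ (n - 1)) * indicator {0<..} r * (f (r *\<^sub>R sgn x) * indicator A x))" for r
      have H [measurable]: "H \<in> borel_measurable borel"
        unfolding H_def by measurable
      have "(\<integral>\<^sup>+r. H r \<partial>lborel) = ennreal (norm x) * (\<integral>\<^sup>+s. H (norm x * s) \<partial>lborel)"
        using nn_integral_real_affine[OF H, of "norm x" 0] False by simp
      also have "\<dots> = (\<integral>\<^sup>+s. ennreal (norm x) * H (norm x * s) \<partial>lborel)"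
        by (rule nn_integral_cmult[symmetric]) measurable
      finally show ?thesis unfolding H_def by (simp only: eq)
    qed (use n in \<open>simp add: A_def\<close>)
  qed
  also have "\<dots> = (\<integral>\<^sup>+s. \<integral>\<^sup>+x. of_nat n * (ennreal (norm x ^ n * s ^ (n - 1)) * indicator {0<..} s * (f (s *\<^sub>R x) * indicator A x)) \<partial>lborel \<partial>lborel)"
    by (rule lborel_pair.Fubini') measurable
  also have "\<dots> = (\<integral>\<^sup>+s. \<integral>\<^sup>+y. of_nat n * (ennreal (norm y ^ n) * f y) * (ennreal (1 / s ^ Suc n) * (if norm y \<le> s then 1 else 0)) \<partial>lborel \<partial>lborel)"
  proof (rule nn_integral_cong)
    fix s :: real
    show "(\<integral>\<^sup>+x. of_nat n * (ennreal (norm x ^ n * s ^ (n - 1)) * indicator {0<..} s * (f (s *\<^sub>R x) * indicator A x)) \<partial>lborel)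
        = (\<integral>\<^sup>+y. of_nat n * (ennreal (norm y ^ n) * f y) * (ennreal (1 / s ^ Suc n) * (if norm y \<le> s then 1 else 0)) \<partial>lborel)"
    proof (cases "s > 0")
      case True
      have "ennreal (s ^ n) * (of_nat n * (ennreal (norm (s *\<^sub>R x) ^ n) * f (s *\<^sub>R x)) * (ennreal (1 / s ^ Suc n) * (if norm (s *\<^sub>R x) \<le> s then 1 else 0)))
          = of_nat n * (ennreal (norm x ^ n * s ^ (n - 1)) * indicator {0<..} s * (f (s *\<^sub>R x) * indicator A x))" for x :: "real^'n"
      proof (cases "x = 0")
        case False
        have "s ^ n * (norm (s *\<^sub>R x) ^ n * (1 / s ^ Suc n)) = norm x ^ n * s ^ (n - 1)"
          using True by (simp add: power_mult_distrib np[of s])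
        then have "ennreal (norm x ^ n * s ^ (n - 1)) = ennreal (s ^ n) * (ennreal (norm (s *\<^sub>R x) ^ n) * ennreal (1 / s ^ Suc n))"
          using True by (simp add: ennreal_mult[symmetric] del: norm_scaleR power_Suc)
        moreover have "(if norm (s *\<^sub>R x) \<le> s then 1 else 0) = (indicator A x :: ennreal)"
          using True False by (auto simp: A_def indicator_def)
        ultimately show ?thesis
          using True by (simp only: mult_ac) simp
      qed (use n True in \<open>simp add: zero_power\<close>)
      note eq = this
      define G where "G y = of_nat n * (ennreal (norm y ^ n) * f y) * (ennreal (1 / s ^ Suc n) * (if norm y \<le> s then 1 else 0))" for y
      have G [measurable]: "G \<in> borel_measurable borel"
        unfolding G_def by measurable
      have "(\<integral>\<^sup>+y. G y \<partial>lborel) = ennreal (s ^ n) * (\<integral>\<^sup>+x. G (s *\<^sub>R x) \<partial>lborel)"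
        using nn_integral_lborel_scaleR[OF G True] by (simp add: n_def)
      also have "\<dots> = (\<integral>\<^sup>+x. ennreal (s ^ n) * G (s *\<^sub>R x) \<partial>lborel)"
        by (rule nn_integral_cmult[symmetric]) measurable
      finally show ?thesis unfolding G_def by (simp only: eq)
    next
      case False
      \<comment> \<open>For \<open>s \<le> 0\<close> the condition \<open>norm y \<le> s\<close>
        leaves at most \<open>y = 0\<close>, where the factor \<open>norm y ^ n\<close> is
        0.\<close>
      then have "ennreal (norm y ^ n) * f y * (ennreal (1 / s ^ Suc n) * (if norm y \<le> s then 1 else 0)) = 0" for y :: "real^'n"
        using order_trans[OF norm_ge_zero, of y s] n by (cases "y = 0") (auto simp: zero_power)
      then show ?thesis using False by (simp only: mult.assoc) simp
    qed
  qed
  also have "\<dots> = (\<integral>\<^sup>+y. \<integral>\<^sup>+s. of_nat n * (ennreal (norm y ^ n) * f y) * (ennreal (1 / s ^ Suc n) * (if norm y \<le> s then 1 else 0)) \<partial>lborel \<partial>lborel)"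
    by (rule lborel_pair.Fubini'[symmetric]) measurable
  also have "\<dots> = (\<integral>\<^sup>+y. indicator (- {0}) y * f y \<partial>lborel)"
  proof (rule nn_integral_cong)
    fix y :: "real^'n"
    show "(\<integral>\<^sup>+s. of_nat n * (ennreal (norm y ^ n) * f y) * (ennreal (1 / s ^ Suc n) * (if norm y \<le> s then 1 else 0)) \<partial>lborel)
        = indicator (- {0}) y * f y"
    proof (cases "y = 0")
      case False
      have "real n * norm y ^ n * (1 / (real n * norm y ^ n)) = 1" using False n by simp
      then have "of_nat n * ennreal (norm y ^ n) * ennreal (1 / (real n * norm y ^ n)) = 1"
        by (simp add: ennreal_of_nat_eq_real_of_nat ennreal_mult[symmetric])
      moreover have "of_nat n * (ennreal (norm y ^ n) * f y) * ennreal (1 / (real n * norm y ^ n))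
          = of_nat n * ennreal (norm y ^ n) * ennreal (1 / (real n * norm y ^ n)) * f y"
        by (simp only: mult_ac)
      moreover have "(\<integral>\<^sup>+s. ennreal (1 / s ^ Suc n) * (if norm y \<le> s then 1 else 0) \<partial>lborel) = ennreal (1 / (real n * norm y ^ n))"
        using False n nn_integral_inverse_power[of "norm y" n] by (simp add: indicator_def of_bool_def)
      ultimately show ?thesis
        using False by (subst nn_integral_cmult) simp_all
    qed (use n in \<open>simp add: zero_power\<close>)
  qed
  also have "\<dots> = (\<integral>\<^sup>+y. f y \<partial>lborel)"
    by (intro nn_integral_cong_AE eventually_mono[OF AE_lborel_singleton[of 0]]) (auto simp: indicator_def)
  finally show ?thesis by (simp add: n_def)
qed

text \<open>The polar formula for indicator functions is an equality of measures. In this form it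
  carries over to complex integrands by the general rules for image measures, products and
  densities.\<close>

lemma lborel_eq_distr_polar:
  "lborel = distr (density lborel (\<lambda>r. ennreal (r ^ (CARD('n) - 1)) * indicator {0<..} r) \<Otimes>\<^sub>M sphere_measure)
    borel (\<lambda>(r, \<omega>). r *\<^sub>R (\<omega> :: real^'n::finite))"
  (is "_ = distr (?M \<Otimes>\<^sub>M _) _ ?p")
proof (rule measure_eqI)
  interpret S: finite_measure "sphere_measure :: (real^'n) measure" by (rule finite_sphere_measure)
  have [measurable]: "(\<lambda>x. x) \<in> borel_measurable (sphere_measure :: (real^'n) measure)"
    by (rule measurable_sphere_measure) simp
  have p [measurable]: "?p \<in> borel_measurable (?M \<Otimes>\<^sub>M sphere_measure)"
    by measurable
  fix B :: "(real^'n) set" assume "B \<in> sets lborel"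
  then have B [measurable]: "B \<in> sets borel" by simp
  have "emeasure (distr (?M \<Otimes>\<^sub>M sphere_measure) borel ?p) B
      = (\<integral>\<^sup>+z. indicator B z \<partial>distr (?M \<Otimes>\<^sub>M sphere_measure) borel ?p)"
    by simp
  also have "\<dots> = (\<integral>\<^sup>+z. indicator B (?p z) \<partial>(?M \<Otimes>\<^sub>M sphere_measure))"
    by (rule nn_integral_distr[OF p]) simp
  also have "\<dots> = (\<integral>\<^sup>+r. \<integral>\<^sup>+\<omega>. indicator B (?p (r, \<omega>)) \<partial>sphere_measure \<partial>?M)"
    by (rule S.nn_integral_fst[OF measurable_compose[OF p], symmetric]) simp
  also have "\<dots> = (\<integral>\<^sup>+r. ennreal (r ^ (CARD('n) - 1)) * indicator {0<..} r
      * (\<integral>\<^sup>+\<omega>. indicator B (r *\<^sub>R \<omega>) \<partial>sphere_measure) \<partial>lborel)"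
  proof -
    have "?p \<in> borel_measurable (lborel \<Otimes>\<^sub>M sphere_measure)"
      by measurable
    then have "(\<lambda>z. indicator B (?p z) :: ennreal) \<in> borel_measurable (lborel \<Otimes>\<^sub>M sphere_measure)"
      by (rule measurable_compose) simp
    from S.borel_measurable_nn_integral_fst[OF this] show ?thesis
      by (subst nn_integral_density) simp_all
  qed
  also have "\<dots> = (\<integral>\<^sup>+x. indicator B x \<partial>lborel)"
    by (rule nn_integral_polar[symmetric]) simp
  finally show "emeasure lborel B = emeasure (distr (?M \<Otimes>\<^sub>M sphere_measure) borel ?p) B"
    by simp
qed simp

lemma integral_polar:
  fixes f :: "real^'n::finite \<Rightarrow> complex"
  assumes f: "integrable lborel f"
  shows "(\<integral>x. f x \<partial>lborel) =
    (LINT r:{0<..}|lborel. of_real (r ^ (CARD('n) - 1)) * (\<integral>\<omega>. f (r *\<^sub>R \<omega>) \<partial>sphere_measure))"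
proof -
  let ?w = "\<lambda>r :: real. ennreal (r ^ (CARD('n) - 1)) * indicator {0<..} r"
  let ?v = "\<lambda>r :: real. r ^ (CARD('n) - 1) * indicator {0<..} r"
  let ?p = "\<lambda>(r, \<omega>). r *\<^sub>R (\<omega> :: real^'n)"
  \<comment> \<open>As \<open>ennreal\<close> of a real function the density is visibly finite,
    which gives sigma-finiteness, and has the form used by \<open>integral_density\<close>.\<close>
  have w: "?w = (\<lambda>r. ennreal (?v r))"
    by (auto simp: fun_eq_iff indicator_def)
  define M where "M = density lborel ?w"
  interpret S: finite_measure "sphere_measure :: (real^'n) measure" by (rule finite_sphere_measure)
  interpret M: sigma_finite_measure M
    unfolding M_def w by (subst sigma_finite_measure.sigma_finite_iff_density_finite[OF lborel.sigma_finite_measure_axioms]) auto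
  interpret P: pair_sigma_finite M "sphere_measure :: (real^'n) measure" ..
  have [measurable]: "(\<lambda>x. x) \<in> borel_measurable (sphere_measure :: (real^'n) measure)"
    by (rule measurable_sphere_measure) simp
  have [measurable_cong]: "sets M = sets borel" by (simp add: M_def)
  have p [measurable]: "?p \<in> borel_measurable (M \<Otimes>\<^sub>M sphere_measure)"
    by measurable
  have [measurable]: "f \<in> borel_measurable borel"
    using f by measurable
  note D = lborel_eq_distr_polar[where 'n = 'n, folded M_def]
  have i: "integrable (M \<Otimes>\<^sub>M sphere_measure) (\<lambda>z. f (?p z))"
    using f by (subst (asm) D) (simp add: integrable_distr_eq)
  have "(\<integral>x. f x \<partial>lborel) = (\<integral>z. f (?p z) \<partial>(M \<Otimes>\<^sub>M sphere_measure))"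
    by (subst D) (simp add: integral_distr)
  also have "\<dots> = (\<integral>r. \<integral>\<omega>. f (r *\<^sub>R \<omega>) \<partial>sphere_measure \<partial>M)"
    using P.integral_fst'[OF i] by simp
  also have "\<dots> = (\<integral>r. ?v r *\<^sub>R (\<integral>\<omega>. f (r *\<^sub>R \<omega>) \<partial>sphere_measure) \<partial>lborel)"
    unfolding M_def w by (intro integral_density) (auto simp: indicator_def)
  finally show ?thesis
    unfolding set_lebesgue_integral_def
    by (simp add: scaleR_conv_of_real mult_ac of_real_indicator)
qed

text \<open>The exponent splits as \<open>(CARD('n) - 1) + 2\<close>: the first part absorbs the
  Jacobian \<open>r ^ (CARD('n) - 1)\<close>, the second leaves the integrable majorant
  \<open>1 / (1 + r) ^ 2\<close>. The sphere has finite measure.\<close>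

lemma integrable_of_decay:
  fixes f :: "real^'n::finite \<Rightarrow> complex"
  assumes f [measurable]: "f \<in> borel_measurable borel"
    and C: "\<And>x. (1 + norm x) ^ (CARD('n) + 1) * norm (f x) \<le> C"
  shows "integrable lborel f"
proof (rule integrableI_bounded)
  interpret S: finite_measure "sphere_measure :: (real^'n) measure" by (rule finite_sphere_measure)
  define s where "s = emeasure (sphere_measure :: (real^'n) measure) (sphere 0 1)"
  have s: "s < \<infinity>"
    using S.emeasure_finite[of "sphere 0 1"] by (simp only: s_def less_top infinity_ennreal_def)
  have "0 \<le> C" using order_trans[OF _ C[of 0]] by simp
  have "(\<integral>\<^sup>+x. norm (f x) \<partial>lborel) = (\<integral>\<^sup>+r. ennreal (r ^ (CARD('n) - 1)) * indicator {0<..} r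
      * (\<integral>\<^sup>+\<omega>. norm (f (r *\<^sub>R \<omega>)) \<partial>sphere_measure) \<partial>lborel)"
    by (rule nn_integral_polar) simp
  also have "\<dots> \<le> (\<integral>\<^sup>+r. s * ennreal (indicator {0<..} r *\<^sub>R (C * (1 / (1 + r) ^ 2))) \<partial>lborel)"
  proof (rule nn_integral_mono)
    fix r :: real
    show "ennreal (r ^ (CARD('n) - 1)) * indicator {0<..} r * (\<integral>\<^sup>+\<omega>. norm (f (r *\<^sub>R \<omega>)) \<partial>sphere_measure)
        \<le> s * ennreal (indicator {0<..} r *\<^sub>R (C * (1 / (1 + r) ^ 2)))"
    proof (cases "r > 0")
      case True
      have "ennreal (r ^ (CARD('n) - 1)) * (\<integral>\<^sup>+\<omega>. norm (f (r *\<^sub>R \<omega>)) \<partial>sphere_measure)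
          = (\<integral>\<^sup>+\<omega>. ennreal (r ^ (CARD('n) - 1)) * norm (f (r *\<^sub>R \<omega>)) \<partial>sphere_measure)"
        by (intro nn_integral_cmult[symmetric] measurable_sphere_measure) measurable
      also have "\<dots> \<le> (\<integral>\<^sup>+(\<omega> :: real^'n). ennreal (C * (1 / (1 + r) ^ 2)) \<partial>sphere_measure)"
      proof (rule nn_integral_mono)
        fix \<omega> :: "real^'n" assume "\<omega> \<in> space sphere_measure"
        then have n: "norm (r *\<^sub>R \<omega>) = r" using True by simp
        have "r ^ (CARD('n) - 1) * (1 + r) ^ 2 * norm (f (r *\<^sub>R \<omega>))
            \<le> (1 + r) ^ (CARD('n) - 1) * (1 + r) ^ 2 * norm (f (r *\<^sub>R \<omega>))"
          using True by (intro mult_right_mono power_mono) auto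
        also have "\<dots> = (1 + norm (r *\<^sub>R \<omega>)) ^ (CARD('n) + 1) * norm (f (r *\<^sub>R \<omega>))"
        proof -
          have "CARD('n) + 1 = (CARD('n) - 1) + 2" using zero_less_card_finite[where 'a = 'n] by linarith
          then show ?thesis by (simp only: n power_add)
        qed
        also have "\<dots> \<le> C" by (rule C)
        finally have "r ^ (CARD('n) - 1) * norm (f (r *\<^sub>R \<omega>)) \<le> C * (1 / (1 + r) ^ 2)"
          using True by (simp add: pos_le_divide_eq mult_ac)
        then show "ennreal (r ^ (CARD('n) - 1)) * norm (f (r *\<^sub>R \<omega>)) \<le> ennreal (C * (1 / (1 + r) ^ 2))"
          using True by (simp add: ennreal_mult[symmetric] ennreal_leI)
      qed
      also have "\<dots> = s * ennreal (C * (1 / (1 + r) ^ 2))"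
        by (simp add: s_def mult.commute)
      finally show ?thesis using True by simp
    qed simp
  qed
  also have "\<dots> = s * (\<integral>\<^sup>+r. ennreal (indicator {0<..} r *\<^sub>R (C * (1 / (1 + r) ^ 2))) \<partial>lborel)"
    by (intro nn_integral_cmult) measurable
  also have "\<dots> < \<infinity>"
  proof -
    have "integrable lborel (\<lambda>r. indicator {0<..} r *\<^sub>R (C * (1 / (1 + r) ^ 2)))"
      using set_integrable_mult_right[OF set_integrable_inverse_square, of C] by (simp add: set_integrable_def)
    then have "(\<integral>\<^sup>+r. ennreal (indicator {0<..} r *\<^sub>R (C * (1 / (1 + r) ^ 2))) \<partial>lborel) < \<infinity>"
      using \<open>0 \<le> C\<close> by (subst nn_integral_eq_integral) (auto simp: indicator_def)
    then show ?thesis using s by (simp add: ennreal_mult_less_top)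
  qed
  finally show "(\<integral>\<^sup>+x. norm (f x) \<partial>lborel) < \<infinity>" .
qed simp

section \<open>Differentiation under the integral sign\<close>

lemma has_vector_derivative_iff_slope:
  "(f has_vector_derivative d) (at x) \<longleftrightarrow> ((\<lambda>y. (f y - f x) /\<^sub>R (y - x)) \<longlongrightarrow> d) (at x)"
proof -
  have "norm (f y - f x - (y - x) *\<^sub>R d) / norm (y - x) = norm ((f y - f x) /\<^sub>R (y - x) - d)" if "y \<noteq> x" for y
  proof -
    have "f y - f x - (y - x) *\<^sub>R d = (y - x) *\<^sub>R ((f y - f x) /\<^sub>R (y - x) - d)"
      using that by (simp add: scaleR_diff_right)
    then show ?thesis using that by simp
  qed
  then have "((\<lambda>y. norm (f y - f x - (y - x) *\<^sub>R d) / norm (y - x)) \<longlongrightarrow> 0) (at x)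
      \<longleftrightarrow> ((\<lambda>y. norm ((f y - f x) /\<^sub>R (y - x) - d)) \<longlongrightarrow> 0) (at x)"
    by (intro tendsto_cong) (simp add: eventually_at_filter)
  then show ?thesis
    by (simp add: has_vector_derivative_def has_derivative_iff_norm bounded_linear_scaleR_left
        tendsto_norm_zero_iff LIM_zero_iff)
qed

text \<open>By the mean value inequality the constant \<open>C\<close> dominates all difference
  quotients, and constants are integrable for a finite measure. Dominated convergence then applies
  along every sequence tending to \<open>x\<close>.\<close>

lemma has_vector_derivative_integral:
  fixes f f' :: "real \<Rightarrow> 'a \<Rightarrow> 'b::{banach, second_countable_topology}"
  assumes "finite_measure M"
    and int: "\<And>x. integrable M (f x)"
    and deriv: "\<And>x \<omega>. \<omega> \<in> space M \<Longrightarrow> ((\<lambda>x. f x \<omega>) has_vector_derivative f' x \<omega>) (at x)"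
    and bound: "\<And>x \<omega>. \<omega> \<in> space M \<Longrightarrow> norm (f' x \<omega>) \<le> C"
    and meas: "f' x \<in> borel_measurable M"
  shows "((\<lambda>x. \<integral>\<omega>. f x \<omega> \<partial>M) has_vector_derivative (\<integral>\<omega>. f' x \<omega> \<partial>M)) (at x)"
proof -
  interpret finite_measure M by fact
  have "((\<lambda>y. ((\<integral>\<omega>. f y \<omega> \<partial>M) - (\<integral>\<omega>. f x \<omega> \<partial>M)) /\<^sub>R (y - x)) \<longlongrightarrow> (\<integral>\<omega>. f' x \<omega> \<partial>M)) (at x)"
    unfolding tendsto_at_iff_sequentially
  proof (intro allI impI, unfold comp_def)
    fix X :: "nat \<Rightarrow> real" assume X: "\<forall>i. X i \<in> UNIV - {x}" "X \<longlonglongrightarrow> x"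
    have "(\<lambda>i. \<integral>\<omega>. (f (X i) \<omega> - f x \<omega>) /\<^sub>R (X i - x) \<partial>M) \<longlonglongrightarrow> (\<integral>\<omega>. f' x \<omega> \<partial>M)"
    proof (rule integral_dominated_convergence[where w = "\<lambda>_. C"])
      show "AE \<omega> in M. (\<lambda>i. (f (X i) \<omega> - f x \<omega>) /\<^sub>R (X i - x)) \<longlonglongrightarrow> f' x \<omega>"
      proof (rule AE_I2)
        fix \<omega> assume "\<omega> \<in> space M"
        from deriv[OF this, of x]
        have "((\<lambda>y. (f y \<omega> - f x \<omega>) /\<^sub>R (y - x)) \<longlongrightarrow> f' x \<omega>) (at x)"
          by (simp add: has_vector_derivative_iff_slope)
        then show "(\<lambda>i. (f (X i) \<omega> - f x \<omega>) /\<^sub>R (X i - x)) \<longlonglongrightarrow> f' x \<omega>"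
          using X unfolding tendsto_at_iff_sequentially comp_def by blast
      qed
      show "AE \<omega> in M. norm ((f (X i) \<omega> - f x \<omega>) /\<^sub>R (X i - x)) \<le> C" for i
      proof (rule AE_I2)
        fix \<omega> assume \<omega>: "\<omega> \<in> space M"
        have "norm (f (X i) \<omega> - f x \<omega>) \<le> C * norm (X i - x)"
        proof (rule differentiable_bound[OF convex_UNIV])
          show "((\<lambda>x. f x \<omega>) has_derivative (\<lambda>h. h *\<^sub>R f' y \<omega>)) (at y)" for y
            using deriv[OF \<omega>] by (simp add: has_vector_derivative_def)
          show "onorm (\<lambda>h. h *\<^sub>R f' y \<omega>) \<le> C" for y
            using mult_left_mono[OF bound[OF \<omega>, of y] abs_ge_zero]
            by (intro onorm_le) (simp add: mult.commute)
        qed auto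
        moreover have "X i \<noteq> x" using X by auto
        ultimately show "norm ((f (X i) \<omega> - f x \<omega>) /\<^sub>R (X i - x)) \<le> C"
          unfolding norm_scaleR abs_inverse divide_inverse_commute[symmetric]
          by (simp add: pos_divide_le_eq)
      qed
    qed (use int meas in auto)
    then show "(\<lambda>i. ((\<integral>\<omega>. f (X i) \<omega> \<partial>M) - (\<integral>\<omega>. f x \<omega> \<partial>M)) /\<^sub>R (X i - x)) \<longlonglongrightarrow> (\<integral>\<omega>. f' x \<omega> \<partial>M)"
      using int by simp
  qed
  then show ?thesis
    by (simp add: has_vector_derivative_iff_slope)
qed

section \<open>Radial means of Schwartz functions\<close>

lemma schwartz_partials_differentiable:
  "schwartz \<phi> \<Longrightarrow> partials is \<phi> differentiable (at x)"
  by (simp add: schwartz_def smooth_on_def)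

lemma schwartz_partials_continuous:
  "schwartz \<phi> \<Longrightarrow> continuous_on A (partials is \<phi>)"
  by (simp add: continuous_at_imp_continuous_on differentiable_imp_continuous_within
      schwartz_partials_differentiable)

lemma schwartz_partials_bound:
  fixes \<phi> :: "real^'n::finite \<Rightarrow> complex"
  assumes "schwartz \<phi>"
  shows "\<exists>C. \<forall>x. (1 + norm x) ^ a * norm (partials is \<phi> x) \<le> C"
proof -
  obtain C where C: "\<And>x. japanese x ^ a * norm (partials is \<phi> x) \<le> C"
    using assms unfolding schwartz_def by blast
  have "(1 + norm x) ^ a * norm (partials is \<phi> x) \<le> 2 ^ a * C" for x
  proof -
    \<comment> \<open>The sum of the two gives \<open>1 + norm x \<le> 2 * japanese x\<close>, which
      explains the factor \<open>2 ^ a\<close>.\<close>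
    have "norm x \<le> japanese x" "1 \<le> japanese x"
      by (simp_all add: japanese_def real_le_rsqrt)
    then have "(1 + norm x) ^ a \<le> (2 * japanese x) ^ a"
      by (intro power_mono) auto
    then have "(1 + norm x) ^ a * norm (partials is \<phi> x) \<le> (2 * japanese x) ^ a * norm (partials is \<phi> x)"
      by (intro mult_right_mono) auto
    also have "\<dots> = 2 ^ a * (japanese x ^ a * norm (partials is \<phi> x))"
      by (simp add: power_mult_distrib)
    also have "\<dots> \<le> 2 ^ a * C"
      by (intro mult_left_mono C) auto
    finally show ?thesis .
  qed
  then show ?thesis by blast
qed

lemma schwartz_integrable:
  fixes \<phi> :: "real^'n::finite \<Rightarrow> complex"
  assumes "schwartz \<phi>"
  shows "integrable lborel \<phi>"
proof -
  obtain C where "\<And>x. (1 + norm x) ^ (CARD('n) + 1) * norm (\<phi> x) \<le> C"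
    using schwartz_partials_bound[OF assms, of "CARD('n) + 1" "[]"]
    unfolding partials.simps(1) by blast
  moreover have "\<phi> \<in> borel_measurable borel"
    using schwartz_partials_continuous[OF assms, of UNIV "[]"]
    by (simp add: borel_measurable_continuous_onI)
  ultimately show ?thesis by (intro integrable_of_decay)
qed

text \<open>This is the chain rule along a ray, with the direction expanded in the standard basis.
  The result is again expressed through \<open>partial\<close>, so the rule can be iterated.\<close>

lemma has_vector_derivative_radial:
  fixes f :: "real^'n::finite \<Rightarrow> complex"
  assumes "f differentiable (at (r *\<^sub>R \<omega>))"
  shows "((\<lambda>r. f (r *\<^sub>R \<omega>)) has_vector_derivative
    (\<Sum>i\<in>UNIV. of_real (\<omega> $ i) * partial i f (r *\<^sub>R \<omega>))) (at r)"
proof -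
  let ?D = "frechet_derivative f (at (r *\<^sub>R \<omega>))"
  have D: "(f has_derivative ?D) (at (r *\<^sub>R \<omega>))"
    using assms by (simp add: frechet_derivative_works)
  then have lin: "linear ?D" by (rule has_derivative_linear)
  have "((\<lambda>r. f (r *\<^sub>R \<omega>)) has_derivative (\<lambda>h. ?D (h *\<^sub>R \<omega>))) (at r)"
    by (rule has_derivative_compose[of "\<lambda>r. r *\<^sub>R \<omega>" "\<lambda>h. h *\<^sub>R \<omega>" r UNIV f ?D])
      (auto intro!: derivative_eq_intros D)
  moreover have "?D (h *\<^sub>R \<omega>) = h *\<^sub>R (\<Sum>i\<in>UNIV. of_real (\<omega> $ i) * partial i f (r *\<^sub>R \<omega>))" for h
  proof -
    have "?D (h *\<^sub>R \<omega>) = h *\<^sub>R ?D \<omega>"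
      by (rule linear_cmul[OF lin])
    also have "?D \<omega> = ?D (\<Sum>i\<in>UNIV. (\<omega> $ i) *\<^sub>R axis i 1)"
      using basis_expansion[of \<omega>] by (simp add: scalar_mult_eq_scaleR)
    also have "\<dots> = (\<Sum>i\<in>UNIV. of_real (\<omega> $ i) * partial i f (r *\<^sub>R \<omega>))"
      by (simp add: linear_sum[OF lin] linear_cmul[OF lin] partial_def)
        (simp add: scaleR_conv_of_real)
    finally show ?thesis .
  qed
  ultimately show ?thesis by (simp add: has_vector_derivative_def)
qed

text \<open>This is the \<open>m\<close>-th derivative of \<open>\<phi>\<close> along the line
  through 0 in direction \<open>\<omega>\<close>. Summing over ordered lists of directions avoids
  multinomial coefficients and any appeal to the commutation of partial derivatives.\<close>

definition radial_deriv :: "(real^'n::finite \<Rightarrow> complex) \<Rightarrow> nat \<Rightarrow> real \<Rightarrow> real^'n \<Rightarrow> complex" where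
  "radial_deriv \<phi> m r \<omega> = (\<Sum>is\<in>{is. length is = m}.
     of_real (prod_list (map (($) \<omega>) is)) * partials is \<phi> (r *\<^sub>R \<omega>))"

lemma has_vector_derivative_radial_deriv:
  fixes \<phi> :: "real^'n::finite \<Rightarrow> complex"
  assumes "schwartz \<phi>"
  shows "((\<lambda>r. radial_deriv \<phi> m r \<omega>) has_vector_derivative radial_deriv \<phi> (Suc m) r \<omega>) (at r)"
proof -
  let ?w = "\<lambda>is. complex_of_real (prod_list (map (($) \<omega>) is))"
  have "((\<lambda>r. radial_deriv \<phi> m r \<omega>) has_vector_derivative (\<Sum>is\<in>{is. length is = m}.
      ?w is * (\<Sum>i\<in>UNIV. of_real (\<omega> $ i) * partial i (partials is \<phi>) (r *\<^sub>R \<omega>)))) (at r)"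
    unfolding radial_deriv_def
    by (intro has_vector_derivative_sum has_vector_derivative_mult_right has_vector_derivative_radial
        schwartz_partials_differentiable assms)
  also have "(\<Sum>is\<in>{is. length is = m}.
      ?w is * (\<Sum>i\<in>UNIV. of_real (\<omega> $ i) * partial i (partials is \<phi>) (r *\<^sub>R \<omega>)))
      = (\<Sum>is\<in>{is. length is = m}. \<Sum>i\<in>UNIV. ?w (i # is) * partials (i # is) \<phi> (r *\<^sub>R \<omega>))"
    by (simp add: sum_distrib_left mult_ac)
  also have "\<dots> = (\<Sum>i\<in>UNIV. \<Sum>is\<in>{is. length is = m}. ?w (i # is) * partials (i # is) \<phi> (r *\<^sub>R \<omega>))"
    by (rule sum.swap)
  also have "\<dots> = (\<Sum>(i, is)\<in>UNIV \<times> {is. length is = m}. ?w (i # is) * partials (i # is) \<phi> (r *\<^sub>R \<omega>))"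
    by (rule sum.cartesian_product)
  also have "\<dots> = radial_deriv \<phi> (Suc m) r \<omega>"
    unfolding radial_deriv_def
    \<comment> \<open>A list of length \<open>Suc m\<close> is a head, the direction of the latest
      differentiation, and a tail of length \<open>m\<close>.\<close>
    by (rule sum.reindex_bij_witness[where i = "\<lambda>is. (hd is, tl is)" and j = "\<lambda>(i, is). i # is"])
      (auto simp: length_Suc_conv)
  finally show ?thesis .
qed

text \<open>Coordinates of a unit vector are at most 1 in absolute value, and
  \<open>norm (r *\<^sub>R \<omega>)\<close> equals \<open>\<bar>r\<bar>\<close>, so the bounds on
  the partial derivatives add up. The constant is uniform in \<open>\<omega>\<close>, as domination
  on the sphere requires.\<close>

lemma radial_deriv_bound:
  fixes \<phi> :: "real^'n::finite \<Rightarrow> complex"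
  assumes "schwartz \<phi>"
  obtains K where "\<And>r \<omega>. norm \<omega> = 1 \<Longrightarrow> (1 + \<bar>r\<bar>) ^ a * norm (radial_deriv \<phi> m r \<omega>) \<le> K"
proof -
  obtain C where C: "\<And>is x. (1 + norm x) ^ a * norm (partials is \<phi> x) \<le> C is"
    using schwartz_partials_bound[OF assms] by metis
  have "(1 + \<bar>r\<bar>) ^ a * norm (radial_deriv \<phi> m r \<omega>) \<le> (\<Sum>is\<in>{is. length is = m}. C is)"
    if "norm \<omega> = 1" for r and \<omega> :: "real^'n"
  proof -
    have w: "\<bar>prod_list (map (($) \<omega>) is)\<bar> \<le> 1" for "is"
    proof (induction "is")
      case (Cons i "is")
      have "\<bar>\<omega> $ i\<bar> \<le> 1" using component_le_norm_cart[of \<omega> i] that by simp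
      then show ?case using Cons mult_mono[of "\<bar>\<omega> $ i\<bar>" 1 "\<bar>prod_list (map (($) \<omega>) is)\<bar>" 1]
        by (simp add: abs_mult)
    qed simp
    have "norm (radial_deriv \<phi> m r \<omega>) \<le> (\<Sum>is\<in>{is. length is = m}. norm (partials is \<phi> (r *\<^sub>R \<omega>)))"
      unfolding radial_deriv_def
    proof (rule sum_norm_le)
      fix "is" :: "'n list"
      show "norm (of_real (prod_list (map (($) \<omega>) is)) * partials is \<phi> (r *\<^sub>R \<omega>))
          \<le> norm (partials is \<phi> (r *\<^sub>R \<omega>))"
        using mult_right_mono[OF w norm_ge_zero, of "is" "partials is \<phi> (r *\<^sub>R \<omega>)"]
        by (simp add: norm_mult)
    qed
    then have "(1 + \<bar>r\<bar>) ^ a * norm (radial_deriv \<phi> m r \<omega>)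
        \<le> (1 + \<bar>r\<bar>) ^ a * (\<Sum>is\<in>{is. length is = m}. norm (partials is \<phi> (r *\<^sub>R \<omega>)))"
      by (intro mult_left_mono) auto
    also have "\<dots> = (\<Sum>is\<in>{is. length is = m}. (1 + norm (r *\<^sub>R \<omega>)) ^ a * norm (partials is \<phi> (r *\<^sub>R \<omega>)))"
      using that by (simp add: sum_distrib_left)
    also have "\<dots> \<le> (\<Sum>is\<in>{is. length is = m}. C is)"
      by (intro sum_mono C)
    finally show ?thesis .
  qed
  then show thesis by (rule that)
qed

lemma radial_deriv_measurable:
  fixes \<phi> :: "real^'n::finite \<Rightarrow> complex"
  assumes "schwartz \<phi>"
  shows "radial_deriv \<phi> m r \<in> borel_measurable sphere_measure"
proof (intro measurable_sphere_measure borel_measurable_continuous_onI)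
  have "continuous_on UNIV (\<lambda>\<omega> :: real^'n. prod_list (map (($) \<omega>) is))" for "is" :: "'n list"
  proof (induction "is")
    case (Cons i "is")
    have "continuous_on UNIV (\<lambda>\<omega> :: real^'n. \<omega> $ i)"
      by (intro linear_continuous_on bounded_linear_vec_nth)
    from continuous_on_mult[OF this Cons] show ?case by simp
  qed simp
  then show "continuous_on UNIV (radial_deriv \<phi> m r)"
    unfolding radial_deriv_def
    by (intro continuous_intros continuous_on_compose2[OF schwartz_partials_continuous[OF assms, of UNIV]]) auto
qed

lemma radial_deriv_integrable:
  fixes \<phi> :: "real^'n::finite \<Rightarrow> complex"
  assumes "schwartz \<phi>"
  shows "integrable sphere_measure (radial_deriv \<phi> m r)"
proof -
  interpret finite_measure "sphere_measure :: (real^'n) measure" by (rule finite_sphere_measure)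
  obtain K where "\<And>r \<omega>. norm \<omega> = 1 \<Longrightarrow> (1 + \<bar>r\<bar>) ^ 0 * norm (radial_deriv \<phi> m r \<omega>) \<le> K"
    using radial_deriv_bound[OF assms] by blast
  then show ?thesis
    by (intro integrable_const_bound[of _ K] AE_I2 radial_deriv_measurable assms) auto
qed

text \<open>For fixed \<open>\<omega>\<close> the function
  \<open>\<phi> (r *\<^sub>R \<omega>)\<close> is smooth in \<open>r\<close> across 0, so the mean
  is smooth on the whole line. The bound on \<open>radial_deriv\<close> serves twice: as majorant
  for differentiation under the integral and for the decay.\<close>

lemma schwartz_real_sphere_integral:
  fixes \<phi> :: "real^'n::finite \<Rightarrow> complex"
  assumes \<phi>: "schwartz \<phi>"
  shows "schwartz_real (\<lambda>r. \<integral>\<omega>. \<phi> (r *\<^sub>R \<omega>) \<partial>sphere_measure)"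
proof (rule schwartz_realI)
  interpret finite_measure "sphere_measure :: (real^'n) measure" by (rule finite_sphere_measure)
  let ?D = "\<lambda>m r. \<integral>\<omega>. radial_deriv \<phi> m r \<omega> \<partial>sphere_measure"
  show "?D 0 = (\<lambda>r. \<integral>\<omega>. \<phi> (r *\<^sub>R \<omega>) \<partial>sphere_measure)"
    by (simp add: radial_deriv_def)
  fix m
  show "(?D m has_vector_derivative ?D (Suc m) r) (at r)" for r
  proof -
    obtain K where K: "\<And>r \<omega>. norm \<omega> = 1 \<Longrightarrow> (1 + \<bar>r\<bar>) ^ 0 * norm (radial_deriv \<phi> (Suc m) r \<omega>) \<le> K"
      using radial_deriv_bound[OF \<phi>] by blast
    show ?thesis
      by (rule has_vector_derivative_integral[where C = K])
        (use K finite_measure_axioms in \<open>simp_all add: radial_deriv_integrable radial_deriv_measurable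
          has_vector_derivative_radial_deriv \<phi>\<close>)
  qed
  fix a
  obtain K where K: "\<And>r \<omega>. norm \<omega> = 1 \<Longrightarrow> (1 + \<bar>r\<bar>) ^ a * norm (radial_deriv \<phi> m r \<omega>) \<le> K"
    using radial_deriv_bound[OF \<phi>] by blast
  have "(1 + \<bar>r\<bar>) ^ a * norm (?D m r) \<le> (\<integral>(\<omega> :: real^'n). K \<partial>sphere_measure)" for r
  proof -
    have "norm (?D m r) \<le> (\<integral>\<omega>. norm (radial_deriv \<phi> m r \<omega>) \<partial>sphere_measure)"
      by (rule integral_norm_bound)
    then have "(1 + \<bar>r\<bar>) ^ a * norm (?D m r) \<le> (1 + \<bar>r\<bar>) ^ a * (\<integral>\<omega>. norm (radial_deriv \<phi> m r \<omega>) \<partial>sphere_measure)"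
      by (intro mult_left_mono) auto
    also have "\<dots> = (\<integral>\<omega>. (1 + \<bar>r\<bar>) ^ a * norm (radial_deriv \<phi> m r \<omega>) \<partial>sphere_measure)"
      by simp
    also have "\<dots> \<le> (\<integral>(\<omega> :: real^'n). K \<partial>sphere_measure)"
      using K by (intro integral_mono integrable_mult_right integrable_norm radial_deriv_integrable \<phi>) auto
    finally show ?thesis .
  qed
  then show "\<exists>C. \<forall>r. (1 + \<bar>r\<bar>) ^ a * norm (?D m r) \<le> C" by blast
qed

section \<open>The inverse distribution\<close>

text \<open>The part to the right of \<open>b\<close> yields the integral over
  \<open>(b, \<infinity>)\<close> without boundary term. The part to the left, reflected about
  \<open>b\<close>, yields the integral over \<open>(0, b)\<close>. Its cut-off at distance
  \<open>b\<close> from the pole is the origin, where the logarithmic term arises.\<close>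

lemma pole_functional:
  assumes u: "schwartz_real u" and b: "b > 0"
    and h: "\<And>x. x > 0 \<Longrightarrow> h x = of_real ((x - b) ^ Suc m) * u x"
  shows "translated (rplus (Suc m) \<infinity>) b h + (-1) ^ Suc m * translated (rminus (Suc m) (ereal b)) b h
    = (LINT x:{0<..}|lborel. u x)
      + of_real (ln b) * (nderiv m (\<lambda>x. of_real ((x - b) ^ Suc m) * u x) 0 / fact m)"
proof -
  define G where "G x = of_real ((x - b) ^ Suc m) * u x" for x
  have G: "schwartz_real G"
    unfolding G_def by (rule schwartz_real_times_linear_power[OF u])
  \<comment> \<open>The sign from reflecting the power is put into the cofactor.\<close>
  define v where "v x = (-1) ^ Suc m * u (b - x)" for x
  have v: "schwartz_real v"
    unfolding v_def by (intro schwartz_real_cmult schwartz_real_reflect u)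
  have sign: "(b - x - b) ^ Suc m = (-1) ^ Suc m * x ^ Suc m" for x
    by (simp add: power_minus[of x] del: power_Suc)
  have Gv: "G (b - x) = of_real (x ^ Suc m) * v x" for x
    unfolding G_def v_def sign by simp
  have right: "translated (rplus (Suc m) \<infinity>) b h = (LINT s:{0<..}|lborel. u (s + b))"
  proof -
    have "rplus (Suc m) \<infinity> (\<lambda>r. h (r + b)) = (LINT s:einterval 0 \<infinity>|lborel. u (s + b))"
      \<comment> \<open>The choice \<open>e = b\<close> matches the hypothesis on \<open>h\<close>:
        \<open>r + b\<close> is positive for \<open>r > - b\<close>.\<close>
      using rplus_times_power[OF schwartz_real_shift[OF u, of b], of \<infinity> b "\<lambda>r. h (r + b)" m] h b by simp
    then show ?thesis by (simp add: translated_def zero_ereal_def)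
  qed
  have left: "translated (rminus (Suc m) (ereal b)) b h
      = (LINT s:{0<..<b}|lborel. v s) - of_real (ln b) * ((-1) ^ m * nderiv m G 0) / fact m"
  proof -
    \<comment> \<open>Here \<open>e = 1\<close> is an arbitrary choice, as \<open>b - x\<close> is
      positive for every \<open>x < b\<close>.\<close>
    have "h (- x + b) = of_real (x ^ Suc m) * v x" if "- 1 < x" "ereal x < ereal b" for x
    proof -
      have "- x + b = b - x" by simp
      then show ?thesis
        using h[of "b - x"] that unfolding Gv[symmetric] G_def by simp
    qed
    then have "rplus (Suc m) (ereal b) (\<lambda>x. h (- x + b)) = (LINT s:einterval 0 (ereal b)|lborel. v s)
        - of_real (ln b) * nderiv m (\<lambda>x. of_real (x ^ Suc m) * v x) b / fact m"
      using rplus_times_power[OF v, of "ereal b" 1 "\<lambda>x. h (- x + b)" m] b by (simp del: power_Suc)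
    moreover have "nderiv m (\<lambda>x. of_real (x ^ Suc m) * v x) b = (-1) ^ m * nderiv m G 0"
      using nderiv_reflect[OF G, of m b b] by (simp add: Gv del: power_Suc)
    ultimately show ?thesis
      by (simp add: translated_def rminus_def zero_ereal_def del: power_Suc)
  qed
  have 1: "(LINT s:{0<..}|lborel. u (s + b)) = (LINT x:{b<..}|lborel. u x)"
    unfolding set_lebesgue_integral_def
    by (subst (2) lborel_integral_real_affine[of 1 _ b])
      (auto intro!: Bochner_Integration.integral_cong simp: indicator_def add.commute)
  have 2: "(-1) ^ Suc m * (LINT s:{0<..<b}|lborel. v s) = (LINT x:{0<..<b}|lborel. u x)"
  proof -
    have "(-1) ^ Suc m * (LINT s:{0<..<b}|lborel. v s) = (LINT s:{0<..<b}|lborel. (-1) ^ Suc m * v s)"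
      by (rule set_integral_mult_right[symmetric])
    also have "\<dots> = (LINT s:{0<..<b}|lborel. u (b - s))"
      by (simp add: v_def mult.assoc[symmetric] power_mult_distrib[symmetric])
    also have "\<dots> = (LINT x:{0<..<b}|lborel. u x)"
      unfolding set_lebesgue_integral_def
      by (subst (2) lborel_integral_real_affine[of "-1" _ b])
        (auto intro!: Bochner_Integration.integral_cong simp: indicator_def)
    finally show ?thesis .
  qed
  have 3: "(LINT x:{0<..<b}|lborel. u x) + (LINT x:{b<..}|lborel. u x) = (LINT x:{0<..}|lborel. u x)"
  proof -
    have "(LINT x:{0<..<b}|lborel. u x) + (LINT x:{b<..}|lborel. u x)
        = (LINT x:{0<..<b} \<union> {b<..}|lborel. u x)"
      using b by (intro set_integral_Un[symmetric] set_integrable_subset[OF schwartz_real_integrable[OF u]]) auto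
    also have "\<dots> = (LINT x:{0<..}|lborel. u x)"
      using b by (intro set_integral_discrete_difference[of "{b}"]) auto
    finally show ?thesis .
  qed
  \<comment> \<open>The sign of the functional and the sign from differentiating the reflected
    function multiply to -1, so the boundary term enters with a plus.\<close>
  have "(-1) ^ Suc m * (of_real (ln b) * ((-1) ^ m * nderiv m G 0) / fact m)
      = - (of_real (ln b) * (nderiv m G 0 / fact m))"
    by (simp add: power_mult_distrib[symmetric] mult.assoc[symmetric])
  then have "(-1) ^ Suc m * translated (rminus (Suc m) (ereal b)) b h
      = (LINT x:{0<..<b}|lborel. u x) + of_real (ln b) * (nderiv m G 0 / fact m)"
    unfolding left right_diff_distrib 2 by simp
  then show ?thesis
    unfolding right 1 3[symmetric] G_def[abs_def, symmetric] by simp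
qed

text \<open>Off the origin the quotient of \<open>p\<close> by \<open>g\<close> is radial and leaves
  the integral over the sphere. The radial factor \<open>w\<close> is kept general: it is the
  Jacobian power for the poles and 1 for the delta terms.\<close>

lemma tensor_sphere_radial:
  fixes p g \<phi> :: "real^'n::finite \<Rightarrow> complex"
  assumes g: "\<And>\<xi>. \<xi> \<noteq> 0 \<Longrightarrow> g \<xi> \<noteq> 0"
    and p: "\<And>\<xi>. \<xi> \<noteq> 0 \<Longrightarrow> p \<xi> = g \<xi> * of_real (P (norm \<xi>))"
    and r: "r > 0"
  shows "(\<integral>\<omega>. w (norm (r *\<^sub>R \<omega>)) * (p (r *\<^sub>R \<omega>) * \<phi> (r *\<^sub>R \<omega>)) / g (r *\<^sub>R \<omega>) \<partial>sphere_measure)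
    = w r * of_real (P r) * (\<integral>\<omega>. \<phi> (r *\<^sub>R \<omega>) \<partial>sphere_measure)"
proof -
  have "(\<integral>\<omega>. w (norm (r *\<^sub>R \<omega>)) * (p (r *\<^sub>R \<omega>) * \<phi> (r *\<^sub>R \<omega>)) / g (r *\<^sub>R \<omega>) \<partial>sphere_measure)
      = (\<integral>\<omega>. w r * of_real (P r) * \<phi> (r *\<^sub>R \<omega>) \<partial>sphere_measure)"
  proof (rule Bochner_Integration.integral_cong[OF refl])
    fix \<omega> :: "real^'n" assume "\<omega> \<in> space sphere_measure"
    then have n: "norm (r *\<^sub>R \<omega>) = r" using r by simp
    then have "r *\<^sub>R \<omega> \<noteq> 0" using r by (metis norm_zero less_irrefl)
    then show "w (norm (r *\<^sub>R \<omega>)) * (p (r *\<^sub>R \<omega>) * \<phi> (r *\<^sub>R \<omega>)) / g (r *\<^sub>R \<omega>) = w r * of_real (P r) * \<phi> (r *\<^sub>R \<omega>)"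
      using g p n by simp
  qed
  then show ?thesis by simp
qed

text \<open>On positive arguments \<open>h\<close> has the same derivatives as \<open>f\<close>,
  which is smooth across 0, so the limits from the right are values of derivatives of
  \<open>f\<close>.\<close>

lemma delta0_eq:
  assumes f: "schwartz_real f" and h: "\<And>x. x > 0 \<Longrightarrow> h x = f x"
  shows "delta0 l h = (-1) ^ l * nderiv l f 0"
proof -
  have "Lim (at_right 0) (nderiv l h) = nderiv l f 0"
  proof (rule tendsto_Lim)
    have "(nderiv l f \<longlongrightarrow> nderiv l f 0) (at_right 0)"
      using schwartz_real_isCont[OF f, where m = l and x = 0] by (simp add: isCont_def filterlim_at_split)
    moreover have "\<forall>\<^sub>F x in at_right 0. nderiv l f x = nderiv l h x"
    proof (rule eventually_mono[OF eventually_at_right_less])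
      fix x :: real assume "0 < x"
      then show "nderiv l f x = nderiv l h x"
        by (intro nderiv_cong_open[of "{0<..}"]) (auto simp: h)
    qed
    ultimately show "(nderiv l h \<longlongrightarrow> nderiv l f 0) (at_right 0)"
      by (simp add: tendsto_cong)
  qed simp
  then show ?thesis by (simp add: delta0_def)
qed

theorem lemma5:
  fixes p g :: "real^'n::finite \<Rightarrow> complex"
    and \<mu> :: real and N :: nat and r :: "nat \<Rightarrow> real" and q :: "nat \<Rightarrow> nat"
    and c :: "nat \<Rightarrow> nat \<Rightarrow> real"
  assumes dim: "CARD('n) \<ge> 2"
    and symbol: "elliptic_symbol \<mu> p"
    and N: "N \<ge> 1"
    and r_pos: "\<And>j. j \<in> {1..N} \<Longrightarrow> 0 < r j"
    and r_mono: "strict_mono_on {1..N} r"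
    and q_pos: "\<And>j. j \<in> {1..N} \<Longrightarrow> q j \<ge> 1"
    and g_smooth: "smooth_on (- {0}) g"
    and g_below: "\<exists>C>0. \<forall>\<xi>. \<xi> \<noteq> 0 \<longrightarrow> C \<le> norm (g \<xi>)"
    and g_above: "\<exists>C. eventually (\<lambda>\<xi>. norm (g \<xi>) \<le> C) (at 0)"
    and g_growth: "\<exists>C m. eventually (\<lambda>\<xi>. norm (g \<xi>) \<le> C * norm \<xi> ^ m) at_infinity"
    and factorization: "\<And>\<xi>. \<xi> \<noteq> 0 \<Longrightarrow> p \<xi> = g \<xi> * complex_of_real (\<Prod>j=1..N. (norm \<xi> - r j) ^ q j)"
    and partial_fractions: "\<And>s::real. s \<notin> r ` {1..N} \<Longrightarrow>
      (\<Prod>j=1..N. 1 / (s - r j) ^ q j) = (\<Sum>j=1..N. \<Sum>k=1..q j. c j k / (s - r j) ^ k)"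
  shows "\<forall>\<phi>. schwartz \<phi> \<longrightarrow>
    inverse_distribution N r q c g (\<lambda>\<xi>. p \<xi> * \<phi> \<xi>) = (\<integral>\<xi>. \<phi> \<xi> \<partial>lborel)"
proof (intro allI impI)
  fix \<phi> :: "real^'n \<Rightarrow> complex" assume \<phi>: "schwartz \<phi>"
  define n where "n = CARD('n)"
  define P where "P s = (\<Prod>j=1..N. (s - r j) ^ q j)" for s :: real
  define \<Phi> where "\<Phi> s = (\<integral>\<omega>. \<phi> (s *\<^sub>R \<omega>) \<partial>sphere_measure)" for s :: real
  define f where "f s = of_real (s ^ (n - 1)) * \<Phi> s" for s
  define Q where "Q s = of_real (P s) * \<Phi> s" for s
  \<comment> \<open>For \<open>k \<le> q j\<close> the polynomial \<open>R j k\<close> is the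
    quotient of \<open>P\<close> by \<open>(s - r j) ^ k\<close>. Lowering the exponent instead of
    dividing keeps it correct at \<open>s = r j\<close>.\<close>
  define q' where "q' j k i = (if i = j then q j - k else q i)" for j k i
  define R where "R j k s = (\<Prod>i=1..N. (s - r i) ^ q' j k i)" for j k and s :: real
  define u where "u j k s = of_real (R j k s) * f s" for j k s
  \<comment> \<open>The functions \<open>h\<close> and \<open>h0\<close> are the radial functions to
    which the definition applies the pole functionals and the delta functionals.\<close>
  define h where "h s = (\<integral>\<omega>. complex_of_real (norm (s *\<^sub>R (\<omega> :: real^'n)) ^ (n - 1))
    * (p (s *\<^sub>R \<omega>) * \<phi> (s *\<^sub>R \<omega>)) / g (s *\<^sub>R \<omega>) \<partial>sphere_measure)" for s :: real
  define h0 where "h0 s = (\<integral>\<omega>. p (s *\<^sub>R \<omega>) * \<phi> (s *\<^sub>R \<omega>) / g (s *\<^sub>R \<omega>) \<partial>sphere_measure)" for s :: real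
  have \<Phi>: "schwartz_real \<Phi>"
    unfolding \<Phi>_def by (rule schwartz_real_sphere_integral[OF \<phi>])
  have f: "schwartz_real f"
    using schwartz_real_times_linear_power[OF \<Phi>, of 0 "n - 1"] by (simp add: f_def[abs_def])
  have Q: "schwartz_real Q"
    unfolding Q_def P_def by (rule schwartz_real_times_prod[OF \<Phi>]) simp
  have u: "schwartz_real (u j k)" for j k
    unfolding u_def R_def by (rule schwartz_real_times_prod[OF f]) simp
  have g0: "g \<xi> \<noteq> 0" if "\<xi> \<noteq> 0" for \<xi>
    using g_below that by fastforce
  have p: "p \<xi> = g \<xi> * of_real (P (norm \<xi>))" if "\<xi> \<noteq> 0" for \<xi>
    using factorization[OF that] by (simp add: P_def)
  have h: "h s = of_real (P s) * f s" if "s > 0" for s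
  proof -
    have "h s = of_real (s ^ (n - 1)) * of_real (P s) * \<Phi> s"
      unfolding h_def \<Phi>_def
      by (rule tensor_sphere_radial[of g p P s "\<lambda>t. of_real (t ^ (n - 1))" \<phi>]) (fact g0 p that)+
    then show ?thesis by (simp add: f_def)
  qed
  have h0: "h0 s = Q s" if "s > 0" for s
  proof -
    have "(\<integral>\<omega>. 1 * (p (s *\<^sub>R \<omega>) * \<phi> (s *\<^sub>R \<omega>)) / g (s *\<^sub>R \<omega>) \<partial>sphere_measure)
        = 1 * of_real (P s) * \<Phi> s"
      unfolding \<Phi>_def
      by (rule tensor_sphere_radial[of g p P s "\<lambda>_. 1" \<phi>]) (fact g0 p that)+
    then show ?thesis by (simp add: h0_def Q_def)
  qed
  have PR: "P s = (s - r j) ^ k * R j k s" if "j \<in> {1..N}" "k \<le> q j" for j k s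
  proof -
    have "R j k s = (s - r j) ^ (q j - k) * (\<Prod>i\<in>{1..N} - {j}. (s - r i) ^ q i)"
      using that unfolding R_def q'_def by (subst prod.remove[of _ j]) (auto intro!: prod.cong)
    moreover have "P s = (s - r j) ^ q j * (\<Prod>i\<in>{1..N} - {j}. (s - r i) ^ q i)"
      using that unfolding P_def by (subst prod.remove[of _ j]) auto
    ultimately show ?thesis
      using that by (simp add: mult.assoc[symmetric] power_add[symmetric])
  qed
  have pole: "translated (rplus k \<infinity>) (r j) h + (-1) ^ k * translated (rminus k (ereal (r j))) (r j) h
      = (LINT x:{0<..}|lborel. u j k x)
        + of_real (ln (r j)) * (if n \<le> k then nderiv (k - n) Q 0 / fact (k - n) else 0)"
    if j: "j \<in> {1..N}" and k: "k \<in> {1..q j}" for j k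
  proof -
    obtain m where m: "k = Suc m" using k by (cases k) auto
    have fac: "of_real ((x - r j) ^ k) * u j k x = of_real (P x) * f x" for x
      using PR[OF j, of k x] k by (simp add: u_def)
    have "translated (rplus k \<infinity>) (r j) h + (-1) ^ k * translated (rminus k (ereal (r j))) (r j) h
        = (LINT x:{0<..}|lborel. u j k x)
          + of_real (ln (r j)) * (nderiv m (\<lambda>x. of_real ((x - r j) ^ k) * u j k x) 0 / fact m)"
      unfolding m
      by (rule pole_functional[OF u r_pos[OF j]]) (simp only: h fac[unfolded m])
    \<comment> \<open>The zero of order \<open>n - 1\<close> coming from the Jacobian turns the
      Taylor coefficient of order \<open>k - 1\<close> into that of \<open>Q\<close> of order
      \<open>k - n\<close>. For \<open>k < n\<close> it is 0, which matches the start of the delta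
      sum at \<open>k = n\<close>.\<close>
    moreover have "(\<lambda>x. of_real ((x - r j) ^ k) * u j k x) = (\<lambda>x. of_real (x ^ (n - 1)) * Q x)"
      unfolding fac by (simp add: f_def Q_def mult_ac)
    moreover have "n - 1 \<le> m \<longleftrightarrow> n \<le> k" "m - (n - 1) = k - n"
      using dim m by (auto simp: n_def)
    ultimately show ?thesis
      by (simp only: nderiv_times_power_at_0[OF Q])
  qed
  have delta: "delta0 l h0 = (-1) ^ l * nderiv l Q 0" for l
    by (rule delta0_eq[OF Q h0])
  have "inverse_distribution N r q c g (\<lambda>\<xi>. p \<xi> * \<phi> \<xi>)
      = (\<Sum>j=1..N. \<Sum>k=1..q j. of_real (c j k) *
          (translated (rplus k \<infinity>) (r j) h + (-1) ^ k * translated (rminus k (ereal (r j))) (r j) h))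
        - (\<Sum>j=1..N. \<Sum>k=n..q j. of_real (c j k * ((-1) ^ (k - n) * ln (r j) / fact (k - n))) * delta0 (k - n) h0)"
    unfolding inverse_distribution_def tensor_sphere_def h_def[abs_def] h0_def[abs_def] n_def ..
  also have "\<dots> = (\<Sum>j=1..N. \<Sum>k=1..q j. of_real (c j k) * (LINT x:{0<..}|lborel. u j k x))"
  proof -
    have "(\<Sum>k=1..q j. of_real (c j k) *
          (translated (rplus k \<infinity>) (r j) h + (-1) ^ k * translated (rminus k (ereal (r j))) (r j) h))
        = (\<Sum>k=1..q j. of_real (c j k) * (LINT x:{0<..}|lborel. u j k x))
          + (\<Sum>k=n..q j. of_real (c j k * ((-1) ^ (k - n) * ln (r j) / fact (k - n))) * delta0 (k - n) h0)"
      if j: "j \<in> {1..N}" for j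
    proof -
      have "(\<Sum>k=1..q j. of_real (c j k) *
            (translated (rplus k \<infinity>) (r j) h + (-1) ^ k * translated (rminus k (ereal (r j))) (r j) h))
          = (\<Sum>k=1..q j. of_real (c j k) * (LINT x:{0<..}|lborel. u j k x))
            + (\<Sum>k=1..q j. of_real (c j k) * (of_real (ln (r j)) *
                (if n \<le> k then nderiv (k - n) Q 0 / fact (k - n) else 0)))"
        using pole[OF j] by (simp add: sum.distrib[symmetric] distrib_left)
      also have "(\<Sum>k=1..q j. of_real (c j k) * (of_real (ln (r j)) *
            (if n \<le> k then nderiv (k - n) Q 0 / fact (k - n) else 0)))
          = (\<Sum>k=n..q j. of_real (c j k * ((-1) ^ (k - n) * ln (r j) / fact (k - n))) * delta0 (k - n) h0)"
      \<comment> \<open>Terms with \<open>k < n\<close> vanish. In the others the sign in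
        \<open>delta0\<close> cancels the sign in its coefficient.\<close>
      proof (rule sum.mono_neutral_cong_right)
        show "{n..q j} \<subseteq> {1..q j}" using dim by (auto simp: n_def)
        fix k assume "k \<in> {n..q j}"
        moreover have "(-1) ^ l * (-1) ^ l = (1::complex)" for l
          by (simp add: power_mult_distrib[symmetric])
        ultimately show "of_real (c j k) * (of_real (ln (r j)) * (if n \<le> k then nderiv (k - n) Q 0 / fact (k - n) else 0))
            = of_real (c j k * ((-1) ^ (k - n) * ln (r j) / fact (k - n))) * delta0 (k - n) h0"
          by (simp add: delta mult.assoc[symmetric])
      qed auto
      finally show ?thesis .
    qed
    then show ?thesis by (simp add: sum.distrib)
  qed
  also have "\<dots> = (LINT x:{0<..}|lborel. f x)"
  proof -
    have i: "integrable lborel (\<lambda>x. indicator {0<..} x *\<^sub>R u j k x)" for j k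
      using schwartz_real_integrable[OF u] by (simp add: set_integrable_def)
    have "(\<integral>x. (\<Sum>j=1..N. \<Sum>k=1..q j. of_real (c j k) * (indicator {0<..} x *\<^sub>R u j k x)) \<partial>lborel)
        = (\<Sum>j=1..N. \<integral>x. (\<Sum>k=1..q j. of_real (c j k) * (indicator {0<..} x *\<^sub>R u j k x)) \<partial>lborel)"
      by (intro Bochner_Integration.integral_sum Bochner_Integration.integrable_sum integrable_mult_right i)
    also have "\<dots> = (\<Sum>j=1..N. \<Sum>k=1..q j. \<integral>x. of_real (c j k) * (indicator {0<..} x *\<^sub>R u j k x) \<partial>lborel)"
      by (intro sum.cong refl Bochner_Integration.integral_sum integrable_mult_right i)
    also have "\<dots> = (\<Sum>j=1..N. \<Sum>k=1..q j. of_real (c j k) * (LINT x:{0<..}|lborel. u j k x))"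
      unfolding set_lebesgue_integral_def integral_mult_right_zero ..
    finally have "(\<Sum>j=1..N. \<Sum>k=1..q j. of_real (c j k) * (LINT x:{0<..}|lborel. u j k x))
        = (\<integral>x. (\<Sum>j=1..N. \<Sum>k=1..q j. of_real (c j k) * (indicator {0<..} x *\<^sub>R u j k x)) \<partial>lborel)" ..
    also have "\<dots> = (\<integral>x. indicator {0<..} x *\<^sub>R f x \<partial>lborel)"
    proof (rule integral_cong_AE)
      \<comment> \<open>The partial fraction identity is available off the finitely many radii
        \<open>r j\<close>, hence almost everywhere.\<close>
      have "AE x in lborel. x \<notin> r ` {1..N}"
        by (intro AE_not_in finite_imp_null_set_lborel) simp
      then show "AE x in lborel. (\<Sum>j=1..N. \<Sum>k=1..q j. of_real (c j k) * (indicator {0<..} x *\<^sub>R u j k x))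
          = indicator {0<..} x *\<^sub>R f x"
      proof (rule eventually_mono)
        fix x assume x: "x \<notin> r ` {1..N}"
        have Px: "P x \<noteq> 0" using x by (auto simp: P_def)
        \<comment> \<open>Multiplied by \<open>P x\<close>, the partial fraction decomposition says
          that the polynomials \<open>R j k\<close> with coefficients \<open>c j k\<close> sum to
          1.\<close>
        have "(\<Sum>j=1..N. \<Sum>k=1..q j. c j k * R j k x) = (\<Sum>j=1..N. \<Sum>k=1..q j. P x * (c j k / (x - r j) ^ k))"
        proof (intro sum.cong refl)
          fix j k assume jk: "j \<in> {1..N}" "k \<in> {1..q j}"
          then have "x - r j \<noteq> 0" using x by auto
          then show "c j k * R j k x = P x * (c j k / (x - r j) ^ k)"
            using PR[of j k x] jk by simp
        qed
        also have "\<dots> = P x * (\<Prod>j=1..N. 1 / (x - r j) ^ q j)"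
          unfolding partial_fractions[OF x] by (simp add: sum_distrib_left)
        also have "\<dots> = 1"
          using Px by (simp add: P_def prod_dividef)
        finally have 1: "(\<Sum>j=1..N. \<Sum>k=1..q j. c j k * R j k x) = 1" .
        have "(\<Sum>j=1..N. \<Sum>k=1..q j. of_real (c j k) * (t *\<^sub>R u j k x))
            = of_real (\<Sum>j=1..N. \<Sum>k=1..q j. c j k * R j k x) * (t *\<^sub>R f x)" for t :: real
          by (simp add: u_def sum_distrib_right scaleR_sum_right mult.assoc)
        from this[of "indicator {0<..} x"] show "(\<Sum>j=1..N. \<Sum>k=1..q j. of_real (c j k) * (indicator {0<..} x *\<^sub>R u j k x))
            = indicator {0<..} x *\<^sub>R f x"
          unfolding 1 by simp
      qed
    qed (use schwartz_real_measurable[OF u] schwartz_real_measurable[OF f] in measurable)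
    finally show ?thesis by (simp add: set_lebesgue_integral_def)
  qed
  also have "\<dots> = (\<integral>\<xi>. \<phi> \<xi> \<partial>lborel)"
    unfolding f_def \<Phi>_def n_def by (rule integral_polar[OF schwartz_integrable[OF \<phi>], symmetric])
  finally show "inverse_distribution N r q c g (\<lambda>\<xi>. p \<xi> * \<phi> \<xi>) = (\<integral>\<xi>. \<phi> \<xi> \<partial>lborel)" .
qed

end
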